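(* Let $\mathrm{ALG}$ be the Ex Ante Pricing with Simulation and Discarding algorithm (defined in the context). Then $\Gamma_{\mathrm{matching\text{-}pricing}}(\mathrm{ALG},\mathrm{OPT}_{\mathrm{offline\text{-}MP}})\ge\frac12$, and no matching/pricing policy obtains a competitive ratio better than $\frac12$ against $\mathrm{OPT}_{\mathrm{offline\text{-}MP}}$.
   Context: Two-stage joint matching and pricing. Instance: finite bipartite graph $G=(D,S,E)$, $D=D_1\cup D_2$ disjoint; supply weights $w_j\ge0$; independent values $v_i\sim F_i$ ($i\in D$), $F_i$ known; given prices $p_i$ for $i\in D_1$. Let $w_i(p)=\mathbb{E}_{v\sim F_i}[v\mid v\ge p]$. A policy, in the first stage, chooses a matching $M_1$ of $G[D_1,S]$ and prices $p_i$ for $i\in D_2$; $i\in D_2$ accepts iff $v_i\ge p_i$ (the policy only observes acceptance); in the second stage it chooses a matching $M_2$ between accepting $D_2$-vertices and supply vertices unmatched by $M_1$. Its market efficiency is $\mathbb{E}\big[\sum_{i\in D_1}w_i(p_i)\mathbf1\{i\in M_1\}+\sum_{i\in D_2}v_i\mathbf1\{v_i\ge p_i,\ i\in M_2\}+\sum_{j\in S}w_j\mathbf1\{j\in M_1\cup M_2\}\big]$. $\mathrm{OPT}_{\mathrm{offline\text{-}MP}}=\mathbb{E}_{(v_i)_{i\in D_2}}[\max_M\sum_{k\in M}\hat w_k]$ over matchings $M$ of $G$ with vertex weights $\hat w_i=w_i(p_i)$ ($i\in D_1$), $\hat w_i=v_i$ ($i\in D_2$), $\hat w_j=w_j$ ($j\in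 S$). $\Gamma_{\mathrm{matching\text{-}pricing}}$ is the minimum over $(G,\{w_j\},\{F_i\},\{p_i\}_{i\in D_1})$ of market efficiency divided by the benchmark. Algorithm: let $\mathcal T_i(q)=\arg\max\{t:1-F_i(t)\ge q\}$. Compute an optimal solution $(x,y)$ of: maximize $\sum_{i\in D_1}w_i(p_i)y_i+\sum_{i\in D_2}w_i(\mathcal T_i(y_i))y_i+\sum_{j\in S}w_jy_j$ s.t. $y_i=\sum_{j\in N(i)}x_{ij}\le1$ ($i\in D$), $y_j=\sum_{i\in N(j)}x_{ij}\le1$ ($j\in S$), $x\ge0$. Set $\theta_j=0$ for all $j$, $M_1=\emptyset$. For each $i\in D_1$ in a fixed order: sample at most one supply vertex $j^\dagger$ with $\Pr[j^\dagger=j]=x_{ij}$; if $j^\dagger$ exists and is unmatched in $M_1$, add $(i,j^\dagger)$ to $M_1$ with probability $1/(2-\theta_{j^\dagger})$ (independent coin); then set $\theta_j\leftarrow\theta_j+x_{ij}$ for all $j\in S$. Offer each $i\in D_2$ the price $p_i=\mathcal T_i(y_i)$. In the second stage, output a maximum vertex-weighted matching $M_2$ between the accepting $D_2$-vertices (weights $w_i(p_i)$) and the supply vertices unmatched by $M_1$ (weights $w_j$).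
   Formalization: The distributions F_i of second-stage demand vertices are assumed continuous, since otherwise T_i(q) is undefined (or the bound fails); values have finite mean and may be negative, P(v_i ≥ p_i) > 0 for i in D_1, and the ratio is an infimum over instances with positive benchmark. *)

theory Defs
  imports "HOL-Probability.Probability"
begin

text \<open>
  Vertices on both sides are labelled by natural numbers; demand and supply labels live in
  separate name spaces, so an edge is a pair (demand, supply).
\<close>

record market =
  early :: "nat set"
  late :: "nat set"
  supplies :: "nat set"
  edges :: "(nat \<times> nat) set"
  supply_wt :: "nat \<Rightarrow> real"
  law :: "nat \<Rightarrow> real measure"
  posted :: "nat \<Rightarrow> real"

text \<open>
  The conditional mean of the value given acceptance.  Prices are extended reals: the price
  \<open>\<infinity>\<close> is never accepted (and the conditional mean is then 0 by the convention on division).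
\<close>

definition cond_mean :: "real measure \<Rightarrow> ereal \<Rightarrow> real" where
  "cond_mean F p =
     (LINT v|F. v * indicator {v. p \<le> ereal v} v) / measure F {v. p \<le> ereal v}"

text \<open>
  Finite means are needed for the objective to be defined, and a positive acceptance probability
  at the posted prices for the conditional means to be defined.  Continuity of the distribution
  function for the late demand vertices is exactly the condition under which the maximum in
  \<open>ex_ante_price\<close> below is attained for every q in [0,1].  The distributions of the early
  vertices may have atoms.
\<close>

definition valid_market :: "market \<Rightarrow> bool" where
  "valid_market I \<longleftrightarrow>
     finite (early I) \<and> finite (late I) \<and> finite (supplies I) \<and> early I \<inter> late I = {} \<and>
     edges I \<subseteq> (early I \<union> late I) \<times> supplies I \<and>
     (\<forall>j\<in>supplies I. 0 \<le> supply_wt I j) \<and>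
     (\<forall>i\<in>early I \<union> late I.
        prob_space (law I i) \<and> sets (law I i) = sets borel \<and> integrable (law I i) (\<lambda>v. v)) \<and>
     (\<forall>i\<in>early I. 0 < measure (law I i) {posted I i..}) \<and>
     (\<forall>i\<in>late I. continuous_on UNIV (cdf (law I i)))"

definition matching :: "(nat \<times> nat) set \<Rightarrow> (nat \<times> nat) set \<Rightarrow> bool" where
  "matching E M \<longleftrightarrow> M \<subseteq> E \<and> inj_on fst M \<and> inj_on snd M"

definition match_weight ::
    "(nat \<Rightarrow> real) \<Rightarrow> (nat \<Rightarrow> real) \<Rightarrow> (nat \<times> nat) set \<Rightarrow> real" where
  "match_weight a b M = (\<Sum>i\<in>fst ` M. a i) + (\<Sum>j\<in>snd ` M. b j)"

definition value_law :: "market \<Rightarrow> (nat \<Rightarrow> real) measure" where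
  "value_law I = PiM (late I) (law I)"

definition offline_opt :: "market \<Rightarrow> real" where
  "offline_opt I = (LINT v|value_law I.
     Max (match_weight
            (\<lambda>i. if i \<in> early I then cond_mean (law I i) (ereal (posted I i)) else v i)
            (supply_wt I) ` {M. matching (edges I) M}))"

text \<open>
  A randomized strategy for one market.  All internal randomness, of both stages, is carried by a
  seed that is independent of the values; the second stage sees the seed and the set of
  accepting late vertices, but not the values.
\<close>

record 'r strategy =
  seed :: "'r measure"
  match1 :: "'r \<Rightarrow> (nat \<times> nat) set"
  price :: "'r \<Rightarrow> nat \<Rightarrow> ereal"
  match2 :: "'r \<Rightarrow> nat set \<Rightarrow> (nat \<times> nat) set"

definition stage1_edges :: "market \<Rightarrow> (nat \<times> nat) set" where
  "stage1_edges I = {(i, j) \<in> edges I. i \<in> early I}"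

definition stage2_edges :: "market \<Rightarrow> (nat \<times> nat) set \<Rightarrow> nat set \<Rightarrow> (nat \<times> nat) set" where
  "stage2_edges I M1 A = {(i, j) \<in> edges I. i \<in> A \<and> j \<notin> snd ` M1}"

definition valid_strategy :: "market \<Rightarrow> 'r strategy \<Rightarrow> bool" where
  "valid_strategy I R \<longleftrightarrow>
     prob_space (seed R) \<and>
     match1 R \<in> measurable (seed R) (count_space UNIV) \<and>
     (\<forall>i\<in>late I. (\<lambda>r. price R r i) \<in> borel_measurable (seed R)) \<and>
     (\<forall>A\<subseteq>late I. (\<lambda>r. match2 R r A) \<in> measurable (seed R) (count_space UNIV)) \<and>
     (AE r in seed R. matching (stage1_edges I) (match1 R r) \<and>
        (\<forall>A\<subseteq>late I. matching (stage2_edges I (match1 R r) A) (match2 R r A)))"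

definition accepting :: "market \<Rightarrow> (nat \<Rightarrow> ereal) \<Rightarrow> (nat \<Rightarrow> real) \<Rightarrow> nat set" where
  "accepting I p v = {i \<in> late I. p i \<le> ereal (v i)}"

definition efficiency :: "market \<Rightarrow> 'r strategy \<Rightarrow> real" where
  "efficiency I R = (LINT (r, v)|(seed R \<Otimes>\<^sub>M value_law I).
     (let M1 = match1 R r; A = accepting I (price R r) v; M2 = match2 R r A in
        (\<Sum>i\<in>early I \<inter> fst ` M1. cond_mean (law I i) (ereal (posted I i))) +
        (\<Sum>i\<in>A \<inter> fst ` M2. v i) +
        (\<Sum>j\<in>supplies I \<inter> snd ` (M1 \<union> M2). supply_wt I j)))"

type_synonym 'r policy = "market \<Rightarrow> 'r strategy"

definition valid_policy :: "'r policy \<Rightarrow> bool" where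
  "valid_policy P \<longleftrightarrow> (\<forall>I. valid_market I \<longrightarrow> valid_strategy I (P I))"

text \<open>Markets with benchmark 0 (it is never negative) are excluded, the ratio being undefined there.\<close>

definition competitive_ratio :: "'r policy \<Rightarrow> ereal" where
  "competitive_ratio P =
     (INF I\<in>{I. valid_market I \<and> 0 < offline_opt I}.
        ereal (efficiency I (P I) / offline_opt I))"

text \<open>The greatest t with 1 - F(t) at least q, over the extended reals (so it is \<open>\<infinity>\<close> for q = 0).\<close>

definition ex_ante_price :: "real measure \<Rightarrow> real \<Rightarrow> ereal" where
  "ex_ante_price F q = (GREATEST t. 1 - measure F {v. ereal v \<le> t} \<ge> q)"

definition demand_load :: "market \<Rightarrow> (nat \<Rightarrow> nat \<Rightarrow> real) \<Rightarrow> nat \<Rightarrow> real" where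
  "demand_load I x i = (\<Sum>j | (i, j) \<in> edges I. x i j)"

definition supply_load :: "market \<Rightarrow> (nat \<Rightarrow> nat \<Rightarrow> real) \<Rightarrow> nat \<Rightarrow> real" where
  "supply_load I x j = (\<Sum>i | (i, j) \<in> edges I. x i j)"

definition feasible :: "market \<Rightarrow> (nat \<Rightarrow> nat \<Rightarrow> real) \<Rightarrow> bool" where
  "feasible I x \<longleftrightarrow>
     (\<forall>i j. 0 \<le> x i j) \<and> (\<forall>i j. (i, j) \<notin> edges I \<longrightarrow> x i j = 0) \<and>
     (\<forall>i\<in>early I \<union> late I. demand_load I x i \<le> 1) \<and>
     (\<forall>j\<in>supplies I. supply_load I x j \<le> 1)"

definition relaxed_value :: "market \<Rightarrow> (nat \<Rightarrow> nat \<Rightarrow> real) \<Rightarrow> real" where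
  "relaxed_value I x =
     (\<Sum>i\<in>early I. cond_mean (law I i) (ereal (posted I i)) * demand_load I x i) +
     (\<Sum>i\<in>late I. cond_mean (law I i) (ex_ante_price (law I i) (demand_load I x i))
                    * demand_load I x i) +
     (\<Sum>j\<in>supplies I. supply_wt I j * supply_load I x j)"

definition relaxed_optimal :: "market \<Rightarrow> (nat \<Rightarrow> nat \<Rightarrow> real) \<Rightarrow> bool" where
  "relaxed_optimal I x \<longleftrightarrow>
     feasible I x \<and> (\<forall>x'. feasible I x' \<longrightarrow> relaxed_value I x' \<le> relaxed_value I x)"

definition sample_supply :: "market \<Rightarrow> (nat \<Rightarrow> nat \<Rightarrow> real) \<Rightarrow> nat \<Rightarrow> nat option pmf" where
  "sample_supply I x i =
     embed_pmf (\<lambda>u. case u of None \<Rightarrow> 1 - demand_load I x i | Some j \<Rightarrow> x i j)"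

fun simulate_discard ::
    "market \<Rightarrow> (nat \<Rightarrow> nat \<Rightarrow> real) \<Rightarrow> nat list \<Rightarrow> (nat \<Rightarrow> real) \<Rightarrow> (nat \<times> nat) set
       \<Rightarrow> (nat \<times> nat) set pmf" where
  "simulate_discard I x [] \<theta> M = return_pmf M"
| "simulate_discard I x (i # ord) \<theta> M =
     bind_pmf (sample_supply I x i) (\<lambda>u.
     bind_pmf
       (case u of
          None \<Rightarrow> return_pmf M
        | Some j \<Rightarrow>
            if j \<in> snd ` M then return_pmf M
            else map_pmf (\<lambda>b. if b then insert (i, j) M else M)
                   (bernoulli_pmf (1 / (2 - \<theta> j))))
       (\<lambda>M'. simulate_discard I x ord (\<lambda>j. \<theta> j + x i j) M'))"

definition max_weight_matching ::
    "(nat \<times> nat) set \<Rightarrow> (nat \<Rightarrow> real) \<Rightarrow> (nat \<Rightarrow> real) \<Rightarrow> (nat \<times> nat) set \<Rightarrow> bool" where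
  "max_weight_matching E a b M \<longleftrightarrow>
     matching E M \<and> (\<forall>M'. matching E M' \<longrightarrow> match_weight a b M' \<le> match_weight a b M)"

text \<open>
  Ex Ante Pricing with Simulation and Discarding.  The optimal solution x, the processing order
  of the early vertices and the tie-breaking rule among maximum-weight second-stage matchings
  are left open; every choice of them is an instance of the algorithm.  The seed is the
  first-stage matching itself.
\<close>

definition ex_ante_strategy ::
    "market \<Rightarrow> (nat \<Rightarrow> nat \<Rightarrow> real) \<Rightarrow> nat list
       \<Rightarrow> ((nat \<times> nat) set \<Rightarrow> nat set \<Rightarrow> (nat \<times> nat) set) \<Rightarrow> (nat \<times> nat) set strategy" where
  "ex_ante_strategy I x ord sel =
     \<lparr> seed = measure_pmf (simulate_discard I x ord (\<lambda>_. 0) {}),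
       match1 = (\<lambda>M1. M1),
       price = (\<lambda>_ i. ex_ante_price (law I i) (demand_load I x i)),
       match2 = sel \<rparr>"

definition ex_ante_pricing_alg :: "(nat \<times> nat) set policy \<Rightarrow> bool" where
  "ex_ante_pricing_alg ALG \<longleftrightarrow>
     (\<forall>I. valid_market I \<longrightarrow>
        (\<exists>x ord sel.
           relaxed_optimal I x \<and> distinct ord \<and> set ord = early I \<and>
           (\<forall>M1. \<forall>A\<subseteq>late I.
              max_weight_matching (stage2_edges I M1 A)
                (\<lambda>i. cond_mean (law I i) (ex_ante_price (law I i) (demand_load I x i)))
                (supply_wt I) (sel M1 A)) \<and>
           ALG I = ex_ante_strategy I x ord sel))"

end

theory Submission
  imports Defs
begin

text \<open>
  Lower bound.  If \<open>x i j\<close> is the probability that a fixed optimal offline matching uses the edge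
  \<open>(i, j)\<close>, then x is feasible, and by the bathtub principle its relaxed value is at least the offline
  benchmark; so the optimum of the relaxation dominates the benchmark.  The simulation adds
  \<open>(i, j)\<close> with probability exactly \<open>x i j / 2\<close>.  Imagine it continued on the late vertices: accepting
  with probability \<open>y i\<close> and then sampling from \<open>x i / y i\<close> is the same as sampling from \<open>x i\<close>, so the
  continued simulation is a possible second stage and is dominated by the maximum-weight matching.

  Upper bound.  One supply vertex is shared by an early vertex of value 1 and a late vertex whose value
  is rarely positive but then large, with positive part of mean 1: every policy earns at most 1, while
  the benchmark tends to 2.
\<close>

subsection \<open>Simulation with discarding\<close>

text \<open>The coin \<open>1 / (2 - \<theta> j)\<close> is tied to the constant 2 from two sides: a
  supply vertex is still free with probability \<open>(2 - \<theta> j) / 2\<close>, so the product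
  leaves half of each edge, and the coin is a probability because loads never exceed 1. The imagined
  continuation on the late vertices cannot be coupled literally, as the only randomness of the
  strategy is its first-stage matching. An induction over the late vertices replaces the coupling:
  it compares expectations through the weight already collected plus the best completion. This half
  guarantee holds for every feasible \<open>x\<close>; optimality enters only in the comparison with
  the benchmark. That the algorithm exists at all needs a maximum of the relaxation. The price may
  jump or be infinite as the load varies, but the revenue is an integral over an upper tail of
  exactly prescribed mass, and that is continuous. Exact masses come from the continuity of the late
  distribution functions. The same condition excludes a two-point law in the hard market, so a
  uniform law takes its place, on an interval that is mostly negative for large
  \<open>K\<close>.\<close>

locale relaxed_solution =
  fixes I :: market and x :: "nat \<Rightarrow> nat \<Rightarrow> real"
  assumes valid: "valid_market I" and feas: "feasible I x"
begin

lemma finite_early [simp]: "finite (early I)"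
  and finite_late [simp]: "finite (late I)"
  and finite_supplies [simp]: "finite (supplies I)"
  and early_late_disjoint: "early I \<inter> late I = {}"
  and edges_subset: "edges I \<subseteq> (early I \<union> late I) \<times> supplies I"
  using valid by (auto simp: valid_market_def)

lemma x_nonneg [simp]: "0 \<le> x i j"
  and x_eq_0: "(i, j) \<notin> edges I \<Longrightarrow> x i j = 0"
  and demand_load_le_1: "i \<in> early I \<union> late I \<Longrightarrow> demand_load I x i \<le> 1"
  and supply_load_le_1: "j \<in> supplies I \<Longrightarrow> supply_load I x j \<le> 1"
  using feas by (auto simp: feasible_def)

lemma demand_load_altdef: "demand_load I x i = (\<Sum>j\<in>supplies I. x i j)"
  unfolding demand_load_def
  by (rule sum.mono_neutral_left) (use edges_subset x_eq_0 in auto)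

lemma supply_load_altdef: "supply_load I x j = (\<Sum>i\<in>early I \<union> late I. x i j)"
  unfolding supply_load_def
  by (rule sum.mono_neutral_left) (use edges_subset x_eq_0 in auto)

lemma demand_load_nonneg: "0 \<le> demand_load I x i"
  unfolding demand_load_altdef by (rule sum_nonneg) simp

text \<open>Feasibility makes the masses legal: the load bound keeps the mass of \<open>None\<close>
  nonnegative, and the total is 1. Only under these two conditions does \<open>embed_pmf\<close>
  return the given masses.\<close>

lemma pmf_sample_supply:
  assumes "i \<in> early I \<union> late I"
  shows "pmf (sample_supply I x i) u
    = (case u of None \<Rightarrow> 1 - demand_load I x i | Some j \<Rightarrow> x i j)"
  unfolding sample_supply_def
proof (rule pmf_embed_pmf)
  let ?f = "\<lambda>u. case u of None \<Rightarrow> 1 - demand_load I x i | Some j \<Rightarrow> x i j"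
  show nonneg: "0 \<le> ?f u" for u
    using demand_load_le_1[OF assms] by (auto split: option.splits)
  have zero: "x i j = 0" if "j \<notin> supplies I" for j
    using that edges_subset by (intro x_eq_0) auto
  have "(\<integral>\<^sup>+u. ennreal (?f u) \<partial>count_space UNIV)
      = (\<Sum>u\<in>insert None (Some ` supplies I). ennreal (?f u))"
    by (rule nn_integral_count_space') (auto split: option.splits simp: zero image_iff)
  also have "\<dots> = ennreal (\<Sum>u\<in>insert None (Some ` supplies I). ?f u)"
    by (rule sum_ennreal) (use nonneg in auto)
  also have "(\<Sum>u\<in>insert None (Some ` supplies I). ?f u) = 1"
    by (subst sum.insert) (auto simp: sum.reindex demand_load_altdef)
  finally show "(\<integral>\<^sup>+u. ennreal (?f u) \<partial>count_space UNIV) = 1"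
    by simp
qed

lemma set_sample_supply:
  assumes "i \<in> early I \<union> late I"
  shows "set_pmf (sample_supply I x i) \<subseteq> insert None (Some ` {j. (i, j) \<in> edges I})"
proof
  fix u assume "u \<in> set_pmf (sample_supply I x i)"
  then show "u \<in> insert None (Some ` {j. (i, j) \<in> edges I})"
    using x_eq_0 by (cases u) (auto simp: set_pmf_eq pmf_sample_supply[OF assms])
qed

lemma finite_edges [simp]: "finite (edges I)"
  by (rule finite_subset[OF edges_subset]) auto

text \<open>The supply side is protected by the test inside the process. The demand side relies on
  processing each vertex once, and none that \<open>M\<close> already uses.\<close>

lemma set_simulate_discard:
  assumes "distinct ord" "set ord \<subseteq> early I \<union> late I" "matching (edges I) M"
    "set ord \<inter> fst ` M = {}" "N \<in> set_pmf (simulate_discard I x ord \<theta> M)"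
  shows "matching (edges I) N \<and> fst ` N \<subseteq> fst ` M \<union> set ord"
  using assms
proof (induction ord arbitrary: \<theta> M)
  case Nil
  then show ?case by auto
next
  case (Cons i ord)
  let ?\<theta> = "\<lambda>j. \<theta> j + x i j"
  from Cons.prems(5) obtain u M' where u: "u \<in> set_pmf (sample_supply I x i)"
    and M': "M' \<in> set_pmf (case u of None \<Rightarrow> return_pmf M
        | Some j \<Rightarrow> if j \<in> snd ` M then return_pmf M
            else map_pmf (\<lambda>b. if b then insert (i, j) M else M) (bernoulli_pmf (1 / (2 - \<theta> j))))"
    and N: "N \<in> set_pmf (simulate_discard I x ord ?\<theta> M')"
    by auto
  have i: "i \<in> early I \<union> late I" using Cons.prems by auto
  have "M' = M \<or> (\<exists>j. (i, j) \<in> edges I \<and> j \<notin> snd ` M \<and> M' = insert (i, j) M)"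
    using u M' set_sample_supply[OF i] by (auto split: option.splits if_splits)
  then show ?case
  proof (elim disjE exE conjE)
    assume "M' = M"
    with Cons.IH[of M ?\<theta>] Cons.prems N show ?case by auto
  next
    fix j assume j: "(i, j) \<in> edges I" "j \<notin> snd ` M" "M' = insert (i, j) M"
    have "matching (edges I) M'"
      using j Cons.prems by (auto simp: matching_def inj_on_def)
    with Cons.IH[of M' ?\<theta>] Cons.prems N j show ?case by auto
  qed
qed

text \<open>Finite support turns expectations over runs into finite sums and makes every real
  function of the outcome integrable.\<close>

lemma finite_set_simulate_discard:
  assumes "set ord \<subseteq> early I \<union> late I"
  shows "finite (set_pmf (simulate_discard I x ord \<theta> M))"
  using assms
proof (induction ord arbitrary: \<theta> M)
  case Nil
  then show ?case by simp
next
  case (Cons i ord)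
  have i: "i \<in> early I \<union> late I" using Cons.prems by simp
  have "finite {j. (i, j) \<in> edges I}"
    by (rule finite_subset[of _ "supplies I"]) (use edges_subset in auto)
  then have "finite (set_pmf (sample_supply I x i))"
    by (intro finite_subset[OF set_sample_supply[OF i]]) auto
  moreover have "finite (set_pmf (map_pmf g (bernoulli_pmf c)))" for g :: "bool \<Rightarrow> (nat \<times> nat) set" and c
    by (rule finite_subset[of _ "g ` UNIV"]) auto
  ultimately show ?case
    using Cons by (auto split: option.splits)
qed

text \<open>Cuts one run over all demand vertices at the stage boundary: the late part starts from
  the early matching, with the early load already in \<open>\<theta>\<close>.\<close>

lemma simulate_discard_append:
  "simulate_discard I x (ord @ ord') \<theta> M =
     bind_pmf (simulate_discard I x ord \<theta> M)
       (simulate_discard I x ord' (\<lambda>j. \<theta> j + (\<Sum>i\<leftarrow>ord. x i j)))"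
proof (induction ord arbitrary: \<theta> M)
  case Nil
  then show ?case by (simp add: bind_return_pmf)
next
  case (Cons i ord)
  have "simulate_discard I x (ord @ ord') (\<lambda>j. \<theta> j + x i j) =
      (\<lambda>M. bind_pmf (simulate_discard I x ord (\<lambda>j. \<theta> j + x i j) M)
         (simulate_discard I x ord' (\<lambda>j. \<theta> j + x i j + (\<Sum>i\<leftarrow>ord. x i j))))"
    by (rule ext) (rule Cons.IH)
  then show ?case by (simp add: bind_assoc_pmf add.assoc)
qed

text \<open>Processing \<open>i\<close> adds \<open>(i, j)\<close> for a free \<open>j\<close> with
  probability \<open>x i j / (2 - \<theta> j)\<close> and otherwise leaves \<open>M\<close> alone.
  The bound on \<open>\<theta>\<close> makes the coin bias a genuine probability. Both the exact
  formula and the domination bound below are inductions on this recursion.\<close>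

lemma expectation_simulate_discard_Cons:
  fixes h :: "(nat \<times> nat) set \<Rightarrow> real"
  defines "E \<equiv> \<lambda>ord \<theta> M. measure_pmf.expectation (simulate_discard I x ord \<theta> M) h"
  assumes ord: "set (i # ord) \<subseteq> early I \<union> late I" and \<theta>: "\<And>j. j \<in> supplies I \<Longrightarrow> \<theta> j \<le> 1"
  shows "E (i # ord) \<theta> M = E ord (\<lambda>j. \<theta> j + x i j) M
    + (\<Sum>j\<in>supplies I - snd ` M. x i j / (2 - \<theta> j) *
        (E ord (\<lambda>j. \<theta> j + x i j) (insert (i, j) M) - E ord (\<lambda>j. \<theta> j + x i j) M))"
proof -
  let ?\<theta> = "\<lambda>j. \<theta> j + x i j"
  let ?step = "\<lambda>u. case u of None \<Rightarrow> return_pmf M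
        | Some j \<Rightarrow> if j \<in> snd ` M then return_pmf M
            else map_pmf (\<lambda>b. if b then insert (i, j) M else M) (bernoulli_pmf (1 / (2 - \<theta> j)))"
  define K where "K = (\<lambda>u. bind_pmf (?step u) (simulate_discard I x ord ?\<theta>))"
  have i: "i \<in> early I \<union> late I" using ord by simp
  have fin: "finite (set_pmf (simulate_discard I x ord \<theta>' M'))" for \<theta>' M'
    using ord by (intro finite_set_simulate_discard) auto
  have K_None: "measure_pmf.expectation (K None) h = E ord ?\<theta> M"
    by (simp add: K_def E_def bind_return_pmf)
  have K_matched: "measure_pmf.expectation (K (Some j)) h = E ord ?\<theta> M" if "j \<in> snd ` M" for j
    using that by (simp add: K_def E_def bind_return_pmf)
  have K_free: "measure_pmf.expectation (K (Some j)) h = E ord ?\<theta> M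
      + 1 / (2 - \<theta> j) * (E ord ?\<theta> (insert (i, j) M) - E ord ?\<theta> M)"
    if "j \<notin> snd ` M" "j \<in> supplies I" for j
  proof -
    have c: "0 \<le> 1 / (2 - \<theta> j)" "1 / (2 - \<theta> j) \<le> 1" using \<theta>[OF that(2)] by auto
    have "K (Some j) = bind_pmf (bernoulli_pmf (1 / (2 - \<theta> j)))
        (\<lambda>b. simulate_discard I x ord ?\<theta> (if b then insert (i, j) M else M))"
      using that by (simp add: K_def bind_map_pmf)
    then have "measure_pmf.expectation (K (Some j)) h =
        (\<Sum>b\<in>UNIV. pmf (bernoulli_pmf (1 / (2 - \<theta> j))) b *\<^sub>R
           measure_pmf.expectation (simulate_discard I x ord ?\<theta> (if b then insert (i, j) M else M)) h)"
      using fin by (simp only:) (rule pmf_expectation_bind, auto)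
    then show ?thesis
      using c by (simp add: UNIV_bool E_def algebra_simps)
  qed
  have fin_step: "finite (set_pmf (?step u))" for u
  proof -
    have "finite (set_pmf (map_pmf g (bernoulli_pmf c)))" for g :: "bool \<Rightarrow> (nat \<times> nat) set" and c
      by (rule finite_subset[of _ "g ` UNIV"]) auto
    then show ?thesis by (auto split: option.splits)
  qed
  have "E (i # ord) \<theta> M = measure_pmf.expectation (bind_pmf (sample_supply I x i) K) h"
    by (simp add: E_def K_def)
  also have "\<dots> = (\<Sum>u\<in>insert None (Some ` supplies I).
      pmf (sample_supply I x i) u *\<^sub>R measure_pmf.expectation (K u) h)"
  proof (rule pmf_expectation_bind)
    show "set_pmf (sample_supply I x i) \<subseteq> insert None (Some ` supplies I)"
      using set_sample_supply[OF i] edges_subset by blast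
    show "finite (set_pmf (K u))" for u
      using fin fin_step by (simp add: K_def)
  qed auto
  also have "\<dots> = (1 - demand_load I x i) * E ord ?\<theta> M
      + (\<Sum>j\<in>supplies I. x i j * measure_pmf.expectation (K (Some j)) h)"
    by (subst sum.insert) (auto simp: sum.reindex pmf_sample_supply[OF i] K_None)
  also have "(\<Sum>j\<in>supplies I. x i j * measure_pmf.expectation (K (Some j)) h) =
      (\<Sum>j\<in>supplies I. x i j * E ord ?\<theta> M
        + (if j \<in> snd ` M then 0
           else x i j / (2 - \<theta> j) * (E ord ?\<theta> (insert (i, j) M) - E ord ?\<theta> M)))"
    by (rule sum.cong) (auto simp: K_matched K_free algebra_simps simp del: image_iff)
  also have "\<dots> = demand_load I x i * E ord ?\<theta> M
      + (\<Sum>j\<in>supplies I. if j \<in> snd ` M then 0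
           else x i j / (2 - \<theta> j) * (E ord ?\<theta> (insert (i, j) M) - E ord ?\<theta> M))"
    by (simp add: sum.distrib sum_distrib_right demand_load_altdef)
  also have "(\<Sum>j\<in>supplies I. if j \<in> snd ` M then 0
           else x i j / (2 - \<theta> j) * (E ord ?\<theta> (insert (i, j) M) - E ord ?\<theta> M)) =
      (\<Sum>j\<in>supplies I - snd ` M. x i j / (2 - \<theta> j) * (E ord ?\<theta> (insert (i, j) M) - E ord ?\<theta> M))"
    by (rule sum.mono_neutral_cong_right) auto
  finally show ?thesis
    by (simp add: algebra_simps)
qed

text \<open>
  Processing i keeps a free supply vertex j free with probability \<open>(2 - \<theta> j - x i j) / (2 - \<theta> j)\<close>,
  so the denominators telescope and every later edge of j gets the same factor \<open>1 / (2 - \<theta> j)\<close>.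
\<close>

lemma expectation_simulate_discard:
  fixes c :: "nat \<times> nat \<Rightarrow> real"
  assumes "distinct ord" "set ord \<subseteq> early I \<union> late I" "finite M"
    "\<And>j. j \<in> supplies I \<Longrightarrow> \<theta> j + (\<Sum>i\<in>set ord. x i j) \<le> 1"
  shows "measure_pmf.expectation (simulate_discard I x ord \<theta> M) (\<lambda>N. \<Sum>e\<in>N. c e)
    = (\<Sum>e\<in>M. c e) + (\<Sum>j\<in>supplies I - snd ` M. \<Sum>i\<in>set ord. x i j * c (i, j) / (2 - \<theta> j))"
  using assms
proof (induction ord arbitrary: \<theta> M)
  case Nil
  then show ?case by simp
next
  case (Cons i ord)
  let ?\<theta> = "\<lambda>j. \<theta> j + x i j" and ?F = "supplies I - snd ` M"
  define R where "R = (\<lambda>j. \<Sum>i'\<in>set ord. x i' j * c (i', j))"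
  have \<theta>': "\<theta> j + x i j \<le> 1" "\<theta> j \<le> 1" if "j \<in> supplies I" for j
  proof -
    have "0 \<le> (\<Sum>i\<in>set ord. x i j)" by (rule sum_nonneg) simp
    then show "\<theta> j + x i j \<le> 1" using Cons.prems(1) Cons.prems(4)[OF that] by simp
    then show "\<theta> j \<le> 1" using x_nonneg[of i j] by linarith
  qed
  have IH: "measure_pmf.expectation (simulate_discard I x ord ?\<theta> M') (\<lambda>N. \<Sum>e\<in>N. c e)
     = (\<Sum>e\<in>M'. c e) + (\<Sum>j\<in>supplies I - snd ` M'. R j / (2 - ?\<theta> j))" if "finite M'" for M'
    using Cons.IH[of M' ?\<theta>] Cons.prems that by (simp add: R_def sum_divide_distrib add.assoc)
  \<comment> \<open>Adding \<open>(i, j)\<close> earns \<open>c (i, j)\<close> but takes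
    \<open>j\<close> out of the free vertices and so forfeits its later edges.\<close>
  have diff: "measure_pmf.expectation (simulate_discard I x ord ?\<theta> (insert (i, j) M)) (\<lambda>N. \<Sum>e\<in>N. c e)
      - measure_pmf.expectation (simulate_discard I x ord ?\<theta> M) (\<lambda>N. \<Sum>e\<in>N. c e)
      = c (i, j) - R j / (2 - ?\<theta> j)" if "j \<in> ?F" for j
  proof -
    have "(i, j) \<notin> M" using that by force
    moreover have "supplies I - snd ` insert (i, j) M = ?F - {j}" by auto
    ultimately show ?thesis
      using that \<open>finite M\<close> by (simp add: IH sum_diff1)
  qed
  have "measure_pmf.expectation (simulate_discard I x (i # ord) \<theta> M) (\<lambda>N. \<Sum>e\<in>N. c e) =
     (\<Sum>e\<in>M. c e) + (\<Sum>j\<in>?F. R j / (2 - ?\<theta> j))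
      + (\<Sum>j\<in>?F. x i j / (2 - \<theta> j) * (c (i, j) - R j / (2 - ?\<theta> j)))"
    by (subst expectation_simulate_discard_Cons)
       (use Cons.prems \<theta>' diff in \<open>auto simp: IH\<close>)
  also have "\<dots> = (\<Sum>e\<in>M. c e) + (\<Sum>j\<in>?F. R j / (2 - ?\<theta> j)
      + x i j / (2 - \<theta> j) * (c (i, j) - R j / (2 - ?\<theta> j)))"
    by (simp add: sum.distrib)
  also have "(\<Sum>j\<in>?F. R j / (2 - ?\<theta> j) + x i j / (2 - \<theta> j) * (c (i, j) - R j / (2 - ?\<theta> j))) =
      (\<Sum>j\<in>?F. (x i j * c (i, j) + R j) / (2 - \<theta> j))"
  proof (rule sum.cong)
    fix j assume "j \<in> ?F"
    then have "2 - \<theta> j - x i j \<noteq> 0" "2 - \<theta> j \<noteq> 0" using \<theta>'[of j] by auto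
    then show "R j / (2 - ?\<theta> j) + x i j / (2 - \<theta> j) * (c (i, j) - R j / (2 - ?\<theta> j)) =
        (x i j * c (i, j) + R j) / (2 - \<theta> j)"
      by (simp add: divide_simps) (simp add: algebra_simps)
  qed simp
  also have "\<dots> = (\<Sum>j\<in>?F. \<Sum>i\<in>set (i # ord). x i j * c (i, j) / (2 - \<theta> j))"
    using Cons.prems(1) by (simp add: R_def sum_divide_distrib add_divide_distrib)
  finally show ?case .
qed

text \<open>The probability that \<open>B\<close> is the accepting set within \<open>S\<close> when
  vertices accept independently, each with its load as acceptance probability.\<close>

definition accept_prob :: "nat set \<Rightarrow> nat set \<Rightarrow> real" where
  "accept_prob S B = (\<Prod>i\<in>S. if i \<in> B then demand_load I x i else 1 - demand_load I x i)"

lemma accept_prob_nonneg: "S \<subseteq> early I \<union> late I \<Longrightarrow> 0 \<le> accept_prob S B"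
  unfolding accept_prob_def
  by (rule prod_nonneg) (use demand_load_le_1 demand_load_nonneg in \<open>auto simp: subset_iff\<close>)

text \<open>Conditioning on the decision of \<open>i\<close>.\<close>

lemma sum_accept_prob_insert:
  fixes f :: "nat set \<Rightarrow> real"
  assumes "finite S" "i \<notin> S"
  shows "(\<Sum>B\<in>Pow (insert i S). accept_prob (insert i S) B * f B) =
    (\<Sum>B\<in>Pow S. accept_prob S B *
      ((1 - demand_load I x i) * f B + demand_load I x i * f (insert i B)))"
proof -
  have inj: "inj_on (insert i) (Pow S)"
    using assms(2) by (auto simp: inj_on_def)
  have notin: "accept_prob (insert i S) B = (1 - demand_load I x i) * accept_prob S B"
    if "B \<in> Pow S" for B
    using assms that by (auto simp: accept_prob_def)
  have ins: "accept_prob (insert i S) (insert i B) = demand_load I x i * accept_prob S B" for B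
  proof -
    have "(\<Prod>k\<in>S. if k \<in> insert i B then demand_load I x k else 1 - demand_load I x k) =
        (\<Prod>k\<in>S. if k \<in> B then demand_load I x k else 1 - demand_load I x k)"
      using assms by (intro prod.cong) auto
    then show ?thesis using assms by (simp add: accept_prob_def)
  qed
  have "(\<Sum>B\<in>Pow (insert i S). accept_prob (insert i S) B * f B) =
      (\<Sum>B\<in>Pow S. accept_prob (insert i S) B * f B) +
      (\<Sum>B\<in>Pow S. accept_prob (insert i S) (insert i B) * f (insert i B))"
    unfolding Pow_insert
    by (subst sum.union_disjoint) (use assms in \<open>auto simp: sum.reindex[OF inj]\<close>)
  also have "\<dots> = (\<Sum>B\<in>Pow S. accept_prob S B *
      ((1 - demand_load I x i) * f B + demand_load I x i * f (insert i B)))"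
    by (simp add: notin ins sum.distrib[symmetric] algebra_simps)
  finally show ?thesis .
qed

text \<open>
  Drawing an acceptance set B and then a supply vertex for each accepting vertex is distributed
  like the sampling step, so the simulated process on the late vertices can be run by a (wasteful)
  second stage; any V that dominates its moves dominates its outcome.
\<close>

lemma expectation_simulate_discard_le:
  fixes V :: "(nat \<times> nat) set \<Rightarrow> nat set \<Rightarrow> real"
  assumes base: "\<And>M. h M \<le> V M {}"
    and skip: "\<And>M B i. i \<in> late I \<Longrightarrow> B \<subseteq> late I \<Longrightarrow> V M B \<le> V M (insert i B)"
    and take: "\<And>M B i j. i \<in> late I - B \<Longrightarrow> B \<subseteq> late I \<Longrightarrow> (i, j) \<in> edges I \<Longrightarrow> j \<notin> snd ` M \<Longrightarrow>
       finite M \<Longrightarrow> V (insert (i, j) M) B \<le> V M (insert i B)"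
    and "distinct ord" "set ord \<subseteq> late I" "finite M"
    and "\<And>j. j \<in> supplies I \<Longrightarrow> \<theta> j + (\<Sum>i\<in>set ord. x i j) \<le> 1"
  shows "measure_pmf.expectation (simulate_discard I x ord \<theta> M) h
    \<le> (\<Sum>B\<in>Pow (set ord). accept_prob (set ord) B * V M B)"
  using assms(4-)
proof (induction ord arbitrary: \<theta> M)
  case Nil
  then show ?case using base by (simp add: accept_prob_def)
next
  case (Cons i ord)
  let ?\<theta> = "\<lambda>j. \<theta> j + x i j" and ?F = "supplies I - snd ` M"
  let ?E = "\<lambda>M. measure_pmf.expectation (simulate_discard I x ord ?\<theta> M) h"
  let ?G = "\<lambda>f. \<Sum>B\<in>Pow (set ord). accept_prob (set ord) B * f B"
  let ?V' = "\<lambda>B. V M (insert i B)"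
  have P: "0 \<le> accept_prob (set ord) B" for B
    using Cons.prems by (intro accept_prob_nonneg) auto
  have \<theta>': "\<theta> j + x i j \<le> 1" "\<theta> j \<le> 1" if "j \<in> supplies I" for j
  proof -
    have "0 \<le> (\<Sum>i\<in>set ord. x i j)" by (rule sum_nonneg) simp
    then show "\<theta> j + x i j \<le> 1" using Cons.prems(1) Cons.prems(4)[OF that] by simp
    then show "\<theta> j \<le> 1" using x_nonneg[of i j] by linarith
  qed
  have IH: "?E M' \<le> ?G (V M')" if "finite M'" for M'
    using Cons.IH[of M' ?\<theta>] Cons.prems that by (simp add: add.assoc)
  have E_le: "?E M \<le> ?G (V M)" by (rule IH) fact
  have G_mono: "?G (V M) \<le> ?G ?V'"
    using skip Cons.prems P by (intro sum_mono mult_left_mono) auto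
  have ins_le: "x i j * ?E (insert (i, j) M) \<le> x i j * ?G ?V'" if "j \<in> ?F" for j
  proof (cases "(i, j) \<in> edges I")
    case True
    have "?E (insert (i, j) M) \<le> ?G (V (insert (i, j) M))"
      using Cons.prems by (intro IH) auto
    also have "\<dots> \<le> ?G ?V'"
      using True that Cons.prems P by (intro sum_mono mult_left_mono take) auto
    finally show ?thesis by (rule mult_left_mono) simp
  qed (simp add: x_eq_0)
  \<comment> \<open>\<open>s\<close> is the probability that the simulation matches
    \<open>i\<close>. A free supply vertex is sampled and kept with probability at most
    \<open>x i j\<close>, so \<open>s\<close> stays below the probability that \<open>i\<close>
    accepts.\<close>
  define s where "s = (\<Sum>j\<in>?F. x i j / (2 - \<theta> j))"
  have "s \<le> (\<Sum>j\<in>?F. x i j)"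
    unfolding s_def
  proof (rule sum_mono)
    fix j assume "j \<in> ?F"
    then have "1 \<le> 2 - \<theta> j" using \<theta>' by auto
    then show "x i j / (2 - \<theta> j) \<le> x i j" 
      using mult_left_mono[of 1 "2 - \<theta> j" "x i j"] by (simp add: divide_le_eq)
  qed
  also have "\<dots> \<le> demand_load I x i"
    unfolding demand_load_altdef by (rule sum_mono2) auto
  finally have s: "s \<le> demand_load I x i" .
  have y: "demand_load I x i \<le> 1" using Cons.prems by (intro demand_load_le_1) auto
  have "measure_pmf.expectation (simulate_discard I x (i # ord) \<theta> M) h
      = ?E M + (\<Sum>j\<in>?F. x i j / (2 - \<theta> j) * (?E (insert (i, j) M) - ?E M))"
    by (rule expectation_simulate_discard_Cons) (use Cons.prems \<theta>' in auto)
  also have "\<dots> = (1 - s) * ?E M + (\<Sum>j\<in>?F. x i j * ?E (insert (i, j) M) / (2 - \<theta> j))"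
    by (simp add: s_def algebra_simps sum_subtractf sum_distrib_left sum_distrib_right)
  also have "\<dots> \<le> (1 - s) * ?G (V M) + (\<Sum>j\<in>?F. x i j * ?G ?V' / (2 - \<theta> j))"
  proof (intro add_mono mult_left_mono[of _ _ "1 - s"] sum_mono divide_right_mono)
    show "0 \<le> 2 - \<theta> j" if "j \<in> ?F" for j using \<theta>'(2)[of j] that by auto
  qed (use s y E_le ins_le in auto)
  also have "(\<Sum>j\<in>?F. x i j * ?G ?V' / (2 - \<theta> j)) = s * ?G ?V'"
    unfolding s_def sum_distrib_right by (intro sum.cong) auto
  also have "(1 - s) * ?G (V M) + s * ?G ?V' = ?G (V M) + s * (?G ?V' - ?G (V M))"
    by (simp add: algebra_simps)
  \<comment> \<open>Raising \<open>s\<close> to the acceptance probability cannot hurt, because by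
    \<open>skip\<close> a further accepting vertex never lowers \<open>V\<close>. The difference is
    what the simulated second stage wastes.\<close>
  also have "\<dots> \<le> ?G (V M) + demand_load I x i * (?G ?V' - ?G (V M))"
    using s G_mono by (intro add_left_mono mult_right_mono) auto
  also have "\<dots> = ?G (\<lambda>B. (1 - demand_load I x i) * V M B + demand_load I x i * ?V' B)"
    by (simp add: algebra_simps sum.distrib sum_subtractf sum_distrib_left)
  also have "\<dots> = (\<Sum>B\<in>Pow (set (i # ord)). accept_prob (set (i # ord)) B * V M B)"
    using Cons.prems by (simp add: sum_accept_prob_insert)
  finally show ?case .
qed

end

subsection \<open>Ex ante prices\<close>

text \<open>On a null acceptance event both sides vanish: division by 0 yields 0, and the integrand
  is 0 almost everywhere. Prices that are never accepted thus need no separate treatment.\<close>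

lemma cond_mean_mult_measure:
  assumes "finite_measure F" "sets F = sets borel"
  shows "cond_mean F p * measure F {v. p \<le> ereal v} = (LINT v|F. v * indicator {v. p \<le> ereal v} v)"
proof (cases "measure F {v. p \<le> ereal v} = 0")
  case True
  interpret finite_measure F by fact
  note [measurable_cong] = assms(2)
  have "{v. p \<le> ereal v} \<in> sets F" by measurable
  with True have "AE v in F. v \<notin> {v. p \<le> ereal v}"
    by (intro AE_not_in) (auto simp: null_sets_def emeasure_eq_measure)
  then have "AE v in F. v * indicator {v. p \<le> ereal v} v = 0" by eventually_elim simp
  then have "(LINT v|F. v * indicator {v. p \<le> ereal v} v) = 0" by (rule integral_eq_zero_AE)
  with True show ?thesis by simp
qed (simp add: cond_mean_def)

lemma measure_ereal_le_eq_cdf: "measure F {v. ereal v \<le> ereal t} = cdf F t"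
  by (simp add: cdf_def atMost_def)

text \<open>A real price is the last point where the distribution function is at most
  \<open>1 - q\<close>. Continuity forces equality there and excludes an atom, so it does not matter
  that a value equal to the price accepts.\<close>

lemma measure_ex_ante_price:
  assumes F: "real_distribution F" and cont: "continuous_on UNIV (cdf F)" and q: "0 \<le> q" "q \<le> 1"
  shows "measure F {v. ex_ante_price F q \<le> ereal v} = q"
proof -
  interpret real_distribution F by fact
  define H where "H = (\<lambda>t. 1 - measure F {v. ereal v \<le> t})"
  have price: "ex_ante_price F q = T" if "q \<le> H T" "\<And>t. q \<le> H t \<Longrightarrow> t \<le> T" for T
    unfolding ex_ante_price_def using that by (intro Greatest_equality) (auto simp: H_def)
  have H_real: "H (ereal t) = 1 - cdf F t" for t
    by (simp only: H_def measure_ereal_le_eq_cdf)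
  have H_inf: "H \<infinity> = 0" and H_minf: "H (-\<infinity>) = 1"
    using prob_space by (auto simp: H_def)
  define C where "C = {t. cdf F t \<le> 1 - q}"
  \<comment> \<open>The prices \<open>\<infinity>\<close>, \<open>-\<infinity>\<close> and a real
    one. An empty \<open>C\<close> forces \<open>q = 1\<close>, since the distribution function
    tends to 0 on the left.\<close>
  consider "q = 0" | "0 < q" "C = {}" | "0 < q" "C \<noteq> {}" using q by fastforce
  then show ?thesis
  proof cases
    case 1
    then have "ex_ante_price F q = \<infinity>" using H_inf by (intro price) auto
    with 1 show ?thesis by simp
  next
    case 2
    have "ex_ante_price F q = -\<infinity>"
    proof (rule price)
      fix t assume t: "q \<le> H t"
      show "t \<le> -\<infinity>"
      proof (cases t)
        case (real r)
        with t have "r \<in> C" by (simp add: H_real C_def)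
        with 2 show ?thesis by simp
      qed (use t 2 H_inf in auto)
    qed (use H_minf q in simp)
    moreover have "1 - q \<le> 0"
      by (rule tendsto_lowerbound[OF cdf_lim_at_bot])
         (use 2 in \<open>auto simp: C_def not_le intro!: always_eventually less_imp_le\<close>)
    ultimately show ?thesis using q prob_space by simp
  next
    case 3
    obtain b where b: "\<And>t. b \<le> t \<Longrightarrow> 1 - q < cdf F t"
      using order_tendstoD(1)[OF cdf_lim_at_top_prob, of "1 - q"] 3
      by (auto simp: eventually_at_top_linorder)
    have bdd: "bdd_above C"
    proof (rule bdd_aboveI)
      show "t \<le> b" if "t \<in> C" for t using b[of t] that by (cases "b \<le> t") (auto simp: C_def)
    qed
    have "closed C"
      unfolding C_def using cont by (intro closed_Collect_le continuous_intros)
    define s where "s = Sup C"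
    have "s \<in> C" unfolding s_def by (rule closed_contains_Sup) (use 3 bdd \<open>closed C\<close> in auto)
    have upper: "t \<le> s" if "cdf F t \<le> 1 - q" for t
      unfolding s_def using that bdd by (intro cSup_upper) (auto simp: C_def)
    have T: "ex_ante_price F q = ereal s"
    proof (rule price)
      show "q \<le> H (ereal s)" using \<open>s \<in> C\<close> by (auto simp: H_real C_def)
      fix t assume t: "q \<le> H t"
      then show "t \<le> ereal s" using 3 H_inf upper by (cases t) (auto simp: H_real)
    qed
    have at_s: "isCont (cdf F) s" using cont by (simp add: continuous_on_eq_continuous_at)
    \<comment> \<open>Points to the right of \<open>s\<close> lie outside \<open>C\<close>, so the
      limit from the right bounds the value at \<open>s\<close> from below.\<close>
    have "1 - q \<le> cdf F s"
    proof (rule tendsto_lowerbound)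
      show "(cdf F \<longlongrightarrow> cdf F s) (at_right s)"
        using at_s by (simp add: continuous_within filterlim_at_split)
      show "\<forall>\<^sub>F t in at_right s. 1 - q \<le> cdf F t"
        using upper
        by (auto simp: eventually_at_filter intro!: always_eventually) (meson linear not_le)
    qed simp
    with \<open>s \<in> C\<close> have cdf_s: "cdf F s = 1 - q" by (simp add: C_def)
    have "measure F {s} = 0" using at_s by (simp add: isCont_cdf)
    moreover have "measure F ({..<s} \<union> {s}) = measure F {..<s} + measure F {s}"
      by (rule finite_measure_Union) auto
    moreover have "{..s} = {..<s} \<union> {s}" by auto
    ultimately have "measure F {..<s} = cdf F s"
      unfolding cdf_def by simp
    moreover have "measure F (space F - {..<s}) = 1 - measure F {..<s}"
      by (rule prob_compl) simp
    moreover have "space F - {..<s} = {s..}" by auto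
    moreover have "{v. ereal s \<le> ereal v} = {s..}" by auto
    ultimately show ?thesis using cdf_s T by simp
  qed
qed

text \<open>
  The bathtub principle: for Q the upper tail of X at a price T with \<open>prob Q = prob G\<close>, the product
  \<open>(X - T) * (indicator Q - indicator G)\<close> is nonnegative.
\<close>

lemma (in prob_space) expectation_event_le_ex_ante:
  assumes X: "random_variable borel X" and X_int: "integrable M X" and F: "F = distr M borel X"
    and cont: "continuous_on UNIV (cdf F)" and G: "G \<in> events"
  shows "expectation (\<lambda>\<omega>. X \<omega> * indicator G \<omega>)
    \<le> cond_mean F (ex_ante_price F (prob G)) * prob G"
proof -
  note [measurable] = X G
  define T where "T = ex_ante_price F (prob G)"
  define Q where "Q = {\<omega> \<in> space M. T \<le> ereal (X \<omega>)}"
  have [measurable]: "Q \<in> events" unfolding Q_def by measurable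
  have rd: "real_distribution F"
    unfolding F by (rule real_distribution_distr) fact
  have TF: "{v. T \<le> ereal v} \<in> sets borel" by measurable
  have mT: "measure F {v. T \<le> ereal v} = prob G"
    unfolding T_def by (rule measure_ex_ante_price) (use rd cont in auto)
  also have "measure F {v. T \<le> ereal v} = prob Q"
    unfolding F by (subst measure_distr) (use TF in \<open>auto simp: Q_def intro!: arg_cong[where f=prob]\<close>)
  finally have QG: "prob Q = prob G" .
  have int: "integrable M (\<lambda>\<omega>. X \<omega> * indicator S \<omega>)" if "S \<in> events" for S
    using X_int that by (rule integrable_real_mult_indicator[rotated])
  have rhs: "cond_mean F T * prob G = expectation (\<lambda>\<omega>. X \<omega> * indicator Q \<omega>)"
  proof -
    have "cond_mean F T * prob G = (LINT v|F. v * indicator {v. T \<le> ereal v} v)"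
      using cond_mean_mult_measure[of F T] rd mT
      by (simp add: real_distribution_def prob_space_def real_distribution_axioms_def)
    also have "\<dots> = expectation (\<lambda>\<omega>. X \<omega> * indicator {v. T \<le> ereal v} (X \<omega>))"
      unfolding F by (rule integral_distr) (use TF in measurable)
    also have "\<dots> = expectation (\<lambda>\<omega>. X \<omega> * indicator Q \<omega>)"
      by (rule Bochner_Integration.integral_cong) (auto simp: Q_def indicator_def)
    finally show ?thesis .
  qed
  have "expectation (\<lambda>\<omega>. X \<omega> * indicator G \<omega>) \<le> expectation (\<lambda>\<omega>. X \<omega> * indicator Q \<omega>)"
  \<comment> \<open>An infinite \<open>T\<close> cannot be subtracted from \<open>X\<close>. In
    those cases \<open>Q\<close> is empty or the whole space, so \<open>G\<close> is null or almost
    sure and the two expectations agree.\<close>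
  proof (cases T)
    case (real t)
    have "0 \<le> expectation (\<lambda>\<omega>. (X \<omega> - t) * (indicator Q \<omega> - indicator G \<omega>))"
      by (rule integral_nonneg_AE)
         (auto simp: Q_def real indicator_def mult_nonneg_nonneg mult_nonpos_nonpos intro!: AE_I2)
    also have "\<dots> = expectation (\<lambda>\<omega>. X \<omega> * indicator Q \<omega> - X \<omega> * indicator G \<omega>
        - (t * indicator Q \<omega> - t * indicator G \<omega>))"
      by (simp add: algebra_simps)
    also have "\<dots> = expectation (\<lambda>\<omega>. X \<omega> * indicator Q \<omega>) - expectation (\<lambda>\<omega>. X \<omega> * indicator G \<omega>)
        - (t * prob Q - t * prob G)"
      using int
      by (subst Bochner_Integration.integral_diff,
          (intro Bochner_Integration.integrable_diff integrable_mult_right integrable_real_indicator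
            | simp add: emeasure_eq_measure)+)+
    finally show ?thesis using QG by simp
  next
    case PInf
    then have "Q = {}" by (auto simp: Q_def)
    with QG have "prob G = 0" by simp
    then have "AE \<omega> in M. \<omega> \<notin> G" by (simp add: prob_eq_0 G)
    then have "AE \<omega> in M. X \<omega> * indicator G \<omega> = 0" by eventually_elim simp
    then show ?thesis using \<open>Q = {}\<close> by (simp add: integral_eq_zero_AE)
  next
    case MInf
    then have "Q = space M" by (auto simp: Q_def)
    with QG have "prob G = 1" by (simp add: prob_space)
    then have "AE \<omega> in M. \<omega> \<in> G" by (simp add: prob_eq_1 G)
    then have "AE \<omega> in M. X \<omega> * indicator G \<omega> = X \<omega> * indicator Q \<omega>"
      using AE_space by eventually_elim (simp add: \<open>Q = space M\<close>)
    then have "expectation (\<lambda>\<omega>. X \<omega> * indicator G \<omega>) = expectation (\<lambda>\<omega>. X \<omega> * indicator Q \<omega>)"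
      by (intro integral_cong_AE) auto
    then show ?thesis by simp
  qed
  with rhs show ?thesis by (simp add: T_def)
qed

text \<open>Absolute continuity of the integral by truncation: the part of \<open>f\<close> above a
  height \<open>n\<close> has a small integral by dominated convergence, and the rest contributes at
  most \<open>n\<close> times the measure of \<open>A\<close>.\<close>

lemma (in finite_measure) integral_indicator_absolutely_continuous:
  fixes f :: "'a \<Rightarrow> real"
  assumes f: "integrable M f" and e: "0 < e"
  obtains d where "0 < d"
    "\<And>A. A \<in> sets M \<Longrightarrow> measure M A < d \<Longrightarrow> (LINT \<omega>|M. \<bar>f \<omega>\<bar> * indicator A \<omega>) < e"
proof -
  define tail where "tail = (\<lambda>n::nat. LINT \<omega>|M. \<bar>f \<omega>\<bar> * indicator {\<omega> \<in> space M. real n < \<bar>f \<omega>\<bar>} \<omega>)"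
  have [measurable]: "f \<in> borel_measurable M" using f by auto
  have "tail \<longlonglongrightarrow> (LINT \<omega>|M. 0)"
    unfolding tail_def
  proof (rule integral_dominated_convergence[where w="\<lambda>\<omega>. \<bar>f \<omega>\<bar>"])
    show "AE \<omega> in M. (\<lambda>n. \<bar>f \<omega>\<bar> * indicator {\<omega> \<in> space M. real n < \<bar>f \<omega>\<bar>} \<omega>) \<longlonglongrightarrow> 0"
    proof (rule AE_I2)
      fix \<omega>
      obtain m :: nat where m: "\<bar>f \<omega>\<bar> \<le> real m" using real_arch_simple by blast
      have "\<forall>\<^sub>F n in sequentially. \<bar>f \<omega>\<bar> * indicator {\<omega> \<in> space M. real n < \<bar>f \<omega>\<bar>} \<omega> = 0"
        using eventually_ge_at_top[of m] by eventually_elim (use m in auto)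
      then show "(\<lambda>n. \<bar>f \<omega>\<bar> * indicator {\<omega> \<in> space M. real n < \<bar>f \<omega>\<bar>} \<omega>) \<longlonglongrightarrow> 0"
        by (rule tendsto_eventually)
    qed
  qed (use f in \<open>auto split: split_indicator\<close>)
  then have "\<forall>\<^sub>F n in sequentially. tail n < e / 2"
    using e by (intro order_tendstoD(2)) auto
  then obtain n where n: "tail n < e / 2" by (auto simp: eventually_sequentially)
  show ?thesis
  proof
    \<comment> \<open>The \<open>+ 1\<close> covers the truncation height 0.\<close>
    show "0 < e / (2 * (real n + 1))" using e by simp
    fix A assume [measurable]: "A \<in> sets M" and A: "measure M A < e / (2 * (real n + 1))"
    have "(LINT \<omega>|M. \<bar>f \<omega>\<bar> * indicator A \<omega>) \<le>
        (LINT \<omega>|M. real n * indicator A \<omega> + \<bar>f \<omega>\<bar> * indicator {\<omega> \<in> space M. real n < \<bar>f \<omega>\<bar>} \<omega>)"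
      using f by (intro integral_mono Bochner_Integration.integrable_add integrable_real_mult_indicator
          integrable_mult_right integrable_real_indicator)
         (auto split: split_indicator simp: emeasure_eq_measure)
    also have "\<dots> = real n * measure M A + tail n"
      unfolding tail_def using f
      by (subst Bochner_Integration.integral_add)
         (auto intro!: integrable_real_mult_indicator simp: emeasure_eq_measure)
    also have "real n * measure M A \<le> (real n + 1) * measure M A"
      by (intro mult_right_mono) auto
    also have "\<dots> < e / 2" using A by (simp add: field_simps)
    finally show "(LINT \<omega>|M. \<bar>f \<omega>\<bar> * indicator A \<omega>) < e" using n by simp
  qed
qed

text \<open>Neither factor is tame by itself: the price jumps where the distribution function is
  flat. The product, however, is the integral of the value over an upper tail of mass exactly
  \<open>q\<close>. Such tails are nested, so two of them differ by a set of mass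
  \<open>\<bar>q' - q\<bar>\<close>, and absolute continuity applies.\<close>

lemma continuous_on_ex_ante_revenue:
  assumes F: "real_distribution F" and cont: "continuous_on UNIV (cdf F)"
    and int: "integrable F (\<lambda>v. v)"
  shows "continuous_on {0..1} (\<lambda>q. cond_mean F (ex_ante_price F q) * q)"
proof -
  interpret real_distribution F by fact
  define U where "U = (\<lambda>q. {v. ex_ante_price F q \<le> ereal v})"
  define R where "R = (\<lambda>q. LINT v|F. v * indicator (U q) v)"
  have [measurable]: "U q \<in> sets borel" for q unfolding U_def by measurable
  have mU: "measure F (U q) = q" if "q \<in> {0..1}" for q
    unfolding U_def using that F cont by (intro measure_ex_ante_price) auto
  have eq: "cond_mean F (ex_ante_price F q) * q = R q" if "q \<in> {0..1}" for q
    using cond_mean_mult_measure[of F "ex_ante_price F q"] mU[OF that] finite_measure_axioms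
    by (simp add: U_def R_def)
  have intU: "integrable F (\<lambda>v. v * indicator (U q) v)" for q
    using int by (intro integrable_real_mult_indicator) auto
  have R_diff: "\<bar>R q' - R q\<bar> \<le> (LINT v|F. \<bar>v\<bar> * indicator (U q' - U q) v)"
    and m_diff: "measure F (U q' - U q) = q' - q"
    if q: "q \<in> {0..1}" "q' \<in> {0..1}" "q \<le> q'" for q q'
  proof -
    have nested: "U q \<subseteq> U q' \<or> U q' \<subseteq> U q" by (auto simp: U_def)
    have md: "measure F (U q' - U q) = q' - q" if "U q \<subseteq> U q'"
      using that q by (subst finite_measure_Diff) (auto simp: mU)
    have md': "measure F (U q - U q') = q - q'" if "U q' \<subseteq> U q"
      using that q by (subst finite_measure_Diff) (auto simp: mU)
    \<comment> \<open>One tail contains the other. If the inclusion went the wrong way, the masses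
      would force \<open>q = q'\<close>.\<close>
    have sub: "U q \<subseteq> U q'"
    proof (rule ccontr)
      assume "\<not> U q \<subseteq> U q'"
      with nested have s: "U q' \<subseteq> U q" by auto
      with md' q measure_nonneg[of F "U q - U q'"] have "q = q'" by linarith
      with \<open>\<not> U q \<subseteq> U q'\<close> show False by simp
    qed
    then show "measure F (U q' - U q) = q' - q" by (rule md)
    have "R q' - R q = (LINT v|F. v * indicator (U q') v - v * indicator (U q) v)"
      unfolding R_def by (rule Bochner_Integration.integral_diff[symmetric]) (rule intU)+
    also have "\<dots> = (LINT v|F. v * indicator (U q' - U q) v)"
      using sub by (intro Bochner_Integration.integral_cong) (auto split: split_indicator)
    finally have "\<bar>R q' - R q\<bar> \<le> (LINT v|F. \<bar>v * indicator (U q' - U q) v\<bar>)"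
      by (simp add: integral_abs_bound)
    then show "\<bar>R q' - R q\<bar> \<le> (LINT v|F. \<bar>v\<bar> * indicator (U q' - U q) v)"
      by (simp add: abs_mult)
  qed
  have "continuous_on {0..1} R"
    unfolding continuous_on_iff
  proof (intro ballI allI impI)
    fix q e :: real assume q: "q \<in> {0..1}" and e: "0 < e"
    obtain d where d: "0 < d"
      "\<And>A. A \<in> sets F \<Longrightarrow> measure F A < d \<Longrightarrow> (LINT \<omega>|F. \<bar>\<omega>\<bar> * indicator A \<omega>) < e"
      using integral_indicator_absolutely_continuous[OF int e] by blast
    have close: "\<bar>R q2 - R q1\<bar> < e" if "q1 \<in> {0..1}" "q2 \<in> {0..1}" "q1 \<le> q2" "q2 - q1 < d" for q1 q2
    proof -
      have "U q2 - U q1 \<in> sets F" by simp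
      then have "(LINT v|F. \<bar>v\<bar> * indicator (U q2 - U q1) v) < e"
        using d(2) m_diff[OF that(1-3)] that(4) by simp
      then show ?thesis using R_diff[OF that(1-3)] by linarith
    qed
    have "dist (R q') (R q) < e" if "q' \<in> {0..1}" "dist q' q < d" for q'
      using close[of q q'] close[of q' q] that q by (cases "q \<le> q'") (auto simp: dist_real_def)
    with d show "\<exists>d>0. \<forall>q'\<in>{0..1}. dist q' q < d \<longrightarrow> dist (R q') (R q) < e" by blast
  qed
  then show ?thesis
    by (rule continuous_on_eq) (simp add: eq)
qed

subsection \<open>The relaxation\<close>

lemma compact_PiE_UNIV:
  fixes S :: "'a \<Rightarrow> 'b::topological_space set"
  assumes "\<And>i. compact (S i)"
  shows "compact (PiE UNIV S)"
  using compactin_PiE[of "\<lambda>_. euclidean" UNIV S] assms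
  by (simp add: euclidean_product_topology)

lemma valid_market_late_law:
  assumes "valid_market I" "i \<in> late I"
  shows "real_distribution (law I i)" "continuous_on UNIV (cdf (law I i))"
    "integrable (law I i) (\<lambda>v. v)"
  using assms
  by (auto simp: valid_market_def real_distribution_def real_distribution_axioms_def)

lemma valid_market_finite_edges: "valid_market I \<Longrightarrow> finite (edges I)"
  unfolding valid_market_def by (meson finite_SigmaI finite_UnI finite_subset)

lemma feasible_le_1:
  assumes "valid_market I" "feasible I x"
  shows "x i j \<le> 1"
proof (cases "(i, j) \<in> edges I")
  case True
  have "finite {j. (i, j) \<in> edges I}"
    by (rule finite_subset[of _ "supplies I"]) (use assms in \<open>auto simp: valid_market_def\<close>)
  then have "x i j \<le> demand_load I x i"
    unfolding demand_load_def using True assms by (intro member_le_sum) (auto simp: feasible_def)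
  also have "\<dots> \<le> 1"
    using True assms by (auto simp: feasible_def valid_market_def)
  finally show ?thesis .
qed (use assms in \<open>auto simp: feasible_def\<close>)

text \<open>A continuous function attains its maximum on a nonempty compact set. The unknown is a
  function on all pairs of naturals, so compactness comes from Tychonoff: edge coordinates range
  over the unit interval and all others are pinned to 0.\<close>

lemma relaxed_optimal_exists:
  assumes valid: "valid_market I"
  obtains x where "relaxed_optimal I x"
proof -
  let ?D = "early I \<union> late I"
  define C where "C = PiE UNIV (\<lambda>i. PiE UNIV (\<lambda>j. if (i, j) \<in> edges I then {0..1::real} else {0}))"
  define S where "S = C \<inter> ((\<Inter>i\<in>?D. {x. demand_load I x i \<le> 1}) \<inter>
    (\<Inter>j\<in>supplies I. {x. supply_load I x j \<le> 1}))"
  have S_eq: "S = {x. feasible I x}"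
  proof (intro set_eqI iffI)
    fix x assume "x \<in> S"
    then have C: "x i j \<in> (if (i, j) \<in> edges I then {0..1} else {0})" for i j
      by (auto simp: S_def C_def PiE_iff)
    have "0 \<le> x i j" "(i, j) \<notin> edges I \<Longrightarrow> x i j = 0" for i j
      using C[of i j] by (auto split: if_splits)
    with \<open>x \<in> S\<close> show "x \<in> {x. feasible I x}" by (auto simp: S_def feasible_def)
  next
    fix x assume "x \<in> {x. feasible I x}"
    then show "x \<in> S"
      using feasible_le_1[OF valid, of x] by (auto simp: S_def C_def feasible_def PiE_iff)
  qed
  have coord: "continuous_on A (\<lambda>x. x i j)" for A :: "(nat \<Rightarrow> nat \<Rightarrow> real) set" and i j
  proof -
    have "continuous_on UNIV (\<lambda>x::nat \<Rightarrow> nat \<Rightarrow> real. x i j)"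
      by (rule continuous_on_product_then_coordinatewise) simp
    then show ?thesis by (rule continuous_on_subset) simp
  qed
  have dem: "continuous_on A (\<lambda>x. demand_load I x i)" for A i
    unfolding demand_load_def by (intro continuous_on_sum coord)
  have sup: "continuous_on A (\<lambda>x. supply_load I x j)" for A j
    unfolding supply_load_def by (intro continuous_on_sum coord)
  have "compact C"
    unfolding C_def by (intro compact_PiE_UNIV) auto
  then have "compact S"
    unfolding S_def
    by (intro compact_Int_closed closed_Int closed_INT ballI closed_Collect_le dem sup) auto
  moreover have "S \<noteq> {}"
  proof -
    have "(\<lambda>_ _. 0) \<in> S" unfolding S_eq by (auto simp: feasible_def demand_load_def supply_load_def)
    then show ?thesis by blast
  qed
  moreover have "continuous_on S (relaxed_value I)"
    unfolding relaxed_value_def[abs_def]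
  proof (intro continuous_on_add continuous_on_sum)
    fix i assume i: "i \<in> late I"
    have "demand_load I x i \<in> {0..1}" if "x \<in> S" for x
      using that i by (auto simp: S_eq feasible_def demand_load_def intro!: sum_nonneg)
    then show "continuous_on S (\<lambda>x. cond_mean (law I i) (ex_ante_price (law I i) (demand_load I x i))
        * demand_load I x i)"
      by (intro continuous_on_compose2[OF continuous_on_ex_ante_revenue dem]
          valid_market_late_law[OF valid i]) auto
  qed (intro continuous_on_mult continuous_on_const dem sup)+
  ultimately obtain x where "x \<in> S" "\<forall>x'\<in>S. relaxed_value I x' \<le> relaxed_value I x"
    using continuous_attains_sup by blast
  then show thesis by (intro that) (auto simp: relaxed_optimal_def S_eq)
qed

text \<open>An optimal matching must be chosen measurably before one can speak of the probability
  that it uses an edge. The induction carries along the measurability of the attained maximum, which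
  the next comparison needs.\<close>

lemma measurable_argmax:
  fixes f :: "'b \<Rightarrow> 'a \<Rightarrow> real"
  assumes "finite S" "S \<noteq> {}" "\<And>m. m \<in> S \<Longrightarrow> f m \<in> borel_measurable M"
  obtains g where "g \<in> measurable M (count_space UNIV)" "\<And>x. g x \<in> S"
    "\<And>x m. m \<in> S \<Longrightarrow> f m x \<le> f (g x) x"
proof -
  have "\<exists>g. g \<in> measurable M (count_space UNIV) \<and> (\<lambda>x. f (g x) x) \<in> borel_measurable M \<and>
      (\<forall>x. g x \<in> S \<and> (\<forall>m\<in>S. f m x \<le> f (g x) x))"
    using assms
  proof (induction S rule: finite_ne_induct)
    case (singleton m)
    then show ?case by (intro exI[of _ "\<lambda>_. m"]) simp
  next
    case (insert m S)
    then obtain g where [measurable]: "g \<in> measurable M (count_space UNIV)"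
        "(\<lambda>x. f (g x) x) \<in> borel_measurable M"
      and g: "\<And>x. g x \<in> S" "\<And>x m. m \<in> S \<Longrightarrow> f m x \<le> f (g x) x"
      by auto
    have [measurable]: "f m \<in> borel_measurable M" using insert.prems by simp
    define h where "h = (\<lambda>x. if f (g x) x \<le> f m x then m else g x)"
    have "h \<in> measurable M (count_space UNIV)"
      unfolding h_def by measurable
    moreover have "(\<lambda>x. f (h x) x) = (\<lambda>x. if f (g x) x \<le> f m x then f m x else f (g x) x)"
      by (auto simp: h_def)
    then have "(\<lambda>x. f (h x) x) \<in> borel_measurable M" by simp
    moreover have "h x \<in> insert m S \<and> (\<forall>m'\<in>insert m S. f m' x \<le> f (h x) x)" for x
      using g(1)[of x] g(2)[of _ x] by (auto simp: h_def intro: order_trans)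
    ultimately show ?case by blast
  qed
  then show thesis using that by blast
qed

lemma finite_matchings: "finite E \<Longrightarrow> finite {M. matching E M}"
  by (rule finite_subset[of _ "Pow E"]) (auto simp: matching_def)

lemma matching_empty [simp]: "matching E {}"
  by (simp add: matching_def)

lemma prob_space_value_law: "valid_market I \<Longrightarrow> prob_space (value_law I)"
  unfolding value_law_def by (rule prob_space_PiM) (auto simp: valid_market_def)

lemma distr_value_law_component:
  assumes "valid_market I" "i \<in> late I"
  shows "distr (value_law I) borel (\<lambda>v. v i) = law I i"
proof -
  have "distr (value_law I) borel (\<lambda>v. v i) = distr (value_law I) (law I i) (\<lambda>v. v i)"
    using assms by (intro distr_cong) (auto simp: valid_market_def)
  also have "\<dots> = law I i"
    unfolding value_law_def using assms by (intro distr_PiM_component) (auto simp: valid_market_def)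
  finally show ?thesis .
qed

lemma measurable_value_law_component:
  assumes "valid_market I" "i \<in> late I"
  shows "(\<lambda>v. v i) \<in> borel_measurable (value_law I)"
proof -
  have "(\<lambda>v. v i) \<in> measurable (value_law I) (law I i)"
    unfolding value_law_def using assms(2) by measurable
  moreover have "sets (law I i) = sets borel" using assms by (auto simp: valid_market_def)
  ultimately show ?thesis by (simp cong: measurable_cong_sets)
qed

lemma integrable_value_law_component:
  assumes "valid_market I" "i \<in> late I"
  shows "integrable (value_law I) (\<lambda>v. v i)"
  using valid_market_late_law(3)[OF assms] measurable_value_law_component[OF assms]
  by (subst (asm) distr_value_law_component[OF assms, symmetric]) (simp add: integrable_distr_eq)

text \<open>Whether a late \<open>i\<close> is matched depends on all the values, but the bathtub
  bound holds for every event. It can therefore be applied to each late vertex separately once the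
  objective is split into one term per vertex.\<close>

lemma offline_opt_le_relaxed_value:
  assumes valid: "valid_market I"
  obtains x where "feasible I x" "offline_opt I \<le> relaxed_value I x"
proof -
  let ?P = "value_law I" and ?E = "edges I"
  let ?w = "\<lambda>i. cond_mean (law I i) (ereal (posted I i))"
  let ?a = "\<lambda>v i. if i \<in> early I then ?w i else v i"
  let ?mw = "\<lambda>M v. match_weight (?a v) (supply_wt I) M"
  interpret P: prob_space ?P by (rule prob_space_value_law) fact
  have fin: "finite (early I)" "finite (late I)" "finite (supplies I)" and disj: "early I \<inter> late I = {}"
    and E: "?E \<subseteq> (early I \<union> late I) \<times> supplies I" "finite ?E"
    using valid valid_market_finite_edges[OF valid] by (auto simp: valid_market_def)
  have decomp: "?mw M v = (\<Sum>i\<in>early I. ?w i * indicator (fst ` M) i)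
      + (\<Sum>i\<in>late I. v i * indicator (fst ` M) i) + (\<Sum>j\<in>supplies I. supply_wt I j * indicator (snd ` M) j)"
    if "matching ?E M" for M v
  proof -
    have sub: "fst ` M \<subseteq> early I \<union> late I" "snd ` M \<subseteq> supplies I"
      using that E by (auto simp: matching_def)
    have "(\<Sum>i\<in>fst ` M. ?a v i) = (\<Sum>i\<in>early I \<union> late I. ?a v i * indicator (fst ` M) i)"
      using sub fin by (intro sum.mono_neutral_cong_left) auto
    also have "\<dots> = (\<Sum>i\<in>early I. ?a v i * indicator (fst ` M) i) + (\<Sum>i\<in>late I. ?a v i * indicator (fst ` M) i)"
      by (rule sum.union_disjoint) (use fin disj in auto)
    also have "(\<Sum>i\<in>late I. ?a v i * indicator (fst ` M) i) = (\<Sum>i\<in>late I. v i * indicator (fst ` M) i)"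
      using disj by (intro sum.cong) auto
    finally have "(\<Sum>i\<in>fst ` M. ?a v i) = (\<Sum>i\<in>early I. ?w i * indicator (fst ` M) i)
      + (\<Sum>i\<in>late I. v i * indicator (fst ` M) i)" by simp
    moreover have "(\<Sum>j\<in>snd ` M. supply_wt I j) = (\<Sum>j\<in>supplies I. supply_wt I j * indicator (snd ` M) j)"
      using sub fin by (intro sum.mono_neutral_cong_left) auto
    ultimately show ?thesis by (simp add: match_weight_def)
  qed
  have meas: "?mw M \<in> borel_measurable ?P" if "M \<in> {M. matching ?E M}" for M
  proof -
    have "?mw M = (\<lambda>v. (\<Sum>i\<in>early I. ?w i * indicator (fst ` M) i)
      + (\<Sum>i\<in>late I. v i * indicator (fst ` M) i) + (\<Sum>j\<in>supplies I. supply_wt I j * indicator (snd ` M) j))"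
      using that by (intro ext decomp) simp
    then show ?thesis
      by (simp only:) (intro borel_measurable_add borel_measurable_sum borel_measurable_times
        borel_measurable_const measurable_value_law_component[OF valid])
  qed
  obtain N where N_meas: "N \<in> measurable ?P (count_space UNIV)" and N: "\<And>v. N v \<in> {M. matching ?E M}"
    and N_max: "\<And>v M. M \<in> {M. matching ?E M} \<Longrightarrow> ?mw M v \<le> ?mw (N v) v"
  proof (rule measurable_argmax[of "{M. matching ?E M}" ?mw ?P])
    show "{M. matching ?E M} \<noteq> {}" using matching_empty by blast
  qed (use meas finite_matchings[OF E(2)] in auto)
  have N_inj: "j = j'" if "(i, j) \<in> N v" "(i, j') \<in> N v" for i j j' v
    using N[of v] that inj_onD[of fst "N v" "(i, j)" "(i, j')"] by (simp add: matching_def)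
  have N_inj': "i = i'" if "(i, j) \<in> N v" "(i', j) \<in> N v" for i i' j v
    using N[of v] that inj_onD[of snd "N v" "(i, j)" "(i', j)"] by (simp add: matching_def)
  have ev: "{v \<in> space ?P. Q (N v)} \<in> P.events" for Q
    using measurable_compose[OF N_meas, of Q "count_space UNIV"] by (simp add: pred_def)
  define x where "x = (\<lambda>i j. if (i, j) \<in> ?E then P.prob {v \<in> space ?P. (i, j) \<in> N v} else 0)"
  \<comment> \<open>The events for different \<open>j\<close> are disjoint because
    \<open>N v\<close> is a matching, so a load is the probability that the vertex is matched; this
    yields the load constraints.\<close>
  have dem: "demand_load I x i = P.prob {v \<in> space ?P. i \<in> fst ` N v}" for i
  proof -
    have "{v \<in> space ?P. i \<in> fst ` N v} = (\<Union>j\<in>{j. (i, j) \<in> ?E}. {v \<in> space ?P. (i, j) \<in> N v})"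
      using N by (force simp: matching_def)
    moreover have "P.prob (\<Union>j\<in>{j. (i, j) \<in> ?E}. {v \<in> space ?P. (i, j) \<in> N v})
        = (\<Sum>j\<in>{j. (i, j) \<in> ?E}. P.prob {v \<in> space ?P. (i, j) \<in> N v})"
    proof (rule P.finite_measure_finite_Union)
      show "finite {j. (i, j) \<in> ?E}" by (rule finite_subset[of _ "supplies I"]) (use E fin in auto)
      show "disjoint_family_on (\<lambda>j. {v \<in> space ?P. (i, j) \<in> N v}) {j. (i, j) \<in> ?E}"
        by (auto simp: disjoint_family_on_def dest: N_inj N_inj')
    qed (use ev in auto)
    ultimately show ?thesis by (simp add: demand_load_def x_def)
  qed
  have sup: "supply_load I x j = P.prob {v \<in> space ?P. j \<in> snd ` N v}" for j
  proof -
    have "{v \<in> space ?P. j \<in> snd ` N v} = (\<Union>i\<in>{i. (i, j) \<in> ?E}. {v \<in> space ?P. (i, j) \<in> N v})"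
      using N by (force simp: matching_def)
    moreover have "P.prob (\<Union>i\<in>{i. (i, j) \<in> ?E}. {v \<in> space ?P. (i, j) \<in> N v})
        = (\<Sum>i\<in>{i. (i, j) \<in> ?E}. P.prob {v \<in> space ?P. (i, j) \<in> N v})"
    proof (rule P.finite_measure_finite_Union)
      show "finite {i. (i, j) \<in> ?E}" by (rule finite_subset[of _ "early I \<union> late I"]) (use E fin in auto)
      show "disjoint_family_on (\<lambda>i. {v \<in> space ?P. (i, j) \<in> N v}) {i. (i, j) \<in> ?E}"
        by (auto simp: disjoint_family_on_def dest: N_inj N_inj')
    qed (use ev in auto)
    ultimately show ?thesis by (simp add: supply_load_def x_def)
  qed
  have ind: "(LINT v|?P. indicator (f ` N v) k) = P.prob {v \<in> space ?P. k \<in> f ` N v}"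
    and ind_int: "integrable ?P (\<lambda>v. indicator (f ` N v) k :: real)" for f :: "nat \<times> nat \<Rightarrow> nat" and k
  proof -
    let ?G = "{v \<in> space ?P. k \<in> f ` N v}"
    have "(LINT v|?P. indicator (f ` N v) k) = (LINT v|?P. indicator ?G v :: real)"
      by (rule Bochner_Integration.integral_cong) (auto simp: indicator_def)
    then show "(LINT v|?P. indicator (f ` N v) k) = P.prob ?G"
      using ev[of "\<lambda>M. k \<in> f ` M"] by (simp add: Int_absorb2)
    have "integrable ?P (indicator ?G :: _ \<Rightarrow> real)"
      using ev[of "\<lambda>M. k \<in> f ` M"] by (intro integrable_real_indicator) (auto simp: P.emeasure_eq_measure)
    then show "integrable ?P (\<lambda>v. indicator (f ` N v) k :: real)"
      by (rule Bochner_Integration.integrable_cong[THEN iffD1, rotated -1]) (auto simp: indicator_def)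
  qed
  have late_int: "integrable ?P (\<lambda>v. v i * indicator (fst ` N v) i)"
    and late_le: "(LINT v|?P. v i * indicator (fst ` N v) i)
      \<le> cond_mean (law I i) (ex_ante_price (law I i) (demand_load I x i)) * demand_load I x i"
    if i: "i \<in> late I" for i
  proof -
    let ?G = "{v \<in> space ?P. i \<in> fst ` N v}"
    have G: "?G \<in> P.events" by (rule ev)
    have "integrable ?P (\<lambda>v. v i * indicator ?G v)"
      by (rule integrable_real_mult_indicator[OF G integrable_value_law_component[OF valid i]])
    then show "integrable ?P (\<lambda>v. v i * indicator (fst ` N v) i)"
      by (rule Bochner_Integration.integrable_cong[THEN iffD1, rotated -1]) (auto simp: indicator_def)
    have "(LINT v|?P. v i * indicator (fst ` N v) i) = (LINT v|?P. v i * indicator ?G v)"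
      by (rule Bochner_Integration.integral_cong) (auto simp: indicator_def)
    also have "\<dots> \<le> cond_mean (law I i) (ex_ante_price (law I i) (P.prob ?G)) * P.prob ?G"
      by (rule P.expectation_event_le_ex_ante)
         (use G i valid valid_market_late_law[OF valid i] in
          \<open>auto simp: distr_value_law_component integrable_value_law_component measurable_value_law_component\<close>)
    finally show "(LINT v|?P. v i * indicator (fst ` N v) i)
      \<le> cond_mean (law I i) (ex_ante_price (law I i) (demand_load I x i)) * demand_load I x i"
      by (simp add: dem)
  qed
  show thesis
  proof
    show "feasible I x"
      by (auto simp: feasible_def dem sup) (auto simp: x_def)
    have "offline_opt I = (LINT v|?P. ?mw (N v) v)"
      unfolding offline_opt_def
    proof (rule Bochner_Integration.integral_cong)
      fix v
      show "Max ((\<lambda>M. ?mw M v) ` {M. matching ?E M}) = ?mw (N v) v"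
        using finite_matchings[OF E(2)] N N_max by (intro Max_eqI) auto
    qed simp
    also have "\<dots> = (LINT v|?P. (\<Sum>i\<in>early I. ?w i * indicator (fst ` N v) i)
        + (\<Sum>i\<in>late I. v i * indicator (fst ` N v) i) + (\<Sum>j\<in>supplies I. supply_wt I j * indicator (snd ` N v) j))"
      using N by (simp add: decomp)
    also have "\<dots> = (\<Sum>i\<in>early I. ?w i * demand_load I x i)
        + (\<Sum>i\<in>late I. LINT v|?P. v i * indicator (fst ` N v) i) + (\<Sum>j\<in>supplies I. supply_wt I j * supply_load I x j)"
      using late_int ind_int by (simp add: ind dem sup)
    also have "\<dots> \<le> relaxed_value I x"
      unfolding relaxed_value_def using late_le by (intro add_mono sum_mono order_refl)
    finally show "offline_opt I \<le> relaxed_value I x" .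
  qed
qed

subsection \<open>Efficiency of the algorithm\<close>

lemma match_weight_eq_sum_edges:
  "matching E M \<Longrightarrow> match_weight a b M = (\<Sum>e\<in>M. a (fst e) + b (snd e))"
  by (simp add: match_weight_def matching_def sum.reindex sum.distrib)

lemma matching_mono: "matching E M \<Longrightarrow> E \<subseteq> E' \<Longrightarrow> matching E' M"
  by (auto simp: matching_def)

lemma integral_prod_value_law:
  fixes f :: "nat \<Rightarrow> real \<Rightarrow> real"
  assumes valid: "valid_market I" and f: "\<And>i. i \<in> late I \<Longrightarrow> integrable (law I i) (f i)"
  shows "integrable (value_law I) (\<lambda>v. \<Prod>i\<in>late I. f i (v i))"
    and "(LINT v|value_law I. (\<Prod>i\<in>late I. f i (v i))) = (\<Prod>i\<in>late I. LINT t|law I i. f i t)"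
proof -
  \<comment> \<open>Padded by a point mass: the product locale wants a sigma-finite measure at every
    index, while nothing is known about \<open>law I i\<close> for labels outside the
    market.\<close>
  define L where "L = (\<lambda>i. if i \<in> late I then law I i else return borel 0)"
  have eq: "value_law I = PiM (late I) L"
    unfolding value_law_def by (rule PiM_cong) (auto simp: L_def)
  have "prob_space (L i)" for i
    using valid by (auto simp: L_def valid_market_def intro: prob_space_return)
  then interpret product_sigma_finite L
    by (auto simp: product_sigma_finite_def prob_space_imp_sigma_finite)
  have fin: "finite (late I)" using valid by (simp add: valid_market_def)
  have int: "integrable (L i) (f i)" if "i \<in> late I" for i using f that by (simp add: L_def)
  show "integrable (value_law I) (\<lambda>v. \<Prod>i\<in>late I. f i (v i))"
    unfolding eq by (rule product_integrable_prod[OF fin int])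
  show "(LINT v|value_law I. (\<Prod>i\<in>late I. f i (v i))) = (\<Prod>i\<in>late I. LINT t|law I i. f i t)"
    unfolding eq by (subst product_integral_prod[OF fin int]) (auto simp: L_def)
qed

lemma integral_pair_times:
  fixes f :: "'a \<Rightarrow> real" and g :: "'b \<Rightarrow> real"
  assumes "prob_space M" "prob_space N" and f: "integrable M f" and g: "integrable N g"
  shows "integrable (M \<Otimes>\<^sub>M N) (\<lambda>(r, v). f r * g v)"
    and "(LINT (r, v)|(M \<Otimes>\<^sub>M N). f r * g v) = (LINT r|M. f r) * (LINT v|N. g v)"
proof -
  interpret M: prob_space M by fact
  interpret N: prob_space N by fact
  interpret pair_sigma_finite M N ..
  have [measurable]: "f \<in> borel_measurable M" "g \<in> borel_measurable N" using f g by auto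
  show int: "integrable (M \<Otimes>\<^sub>M N) (\<lambda>(r, v). f r * g v)"
    by (rule Fubini_integrable) (use f g in \<open>auto simp: abs_mult\<close>)
  show "(LINT (r, v)|(M \<Otimes>\<^sub>M N). f r * g v) = (LINT r|M. f r) * (LINT v|N. g v)"
    using integral_fst'[OF int] by simp
qed

context relaxed_solution
begin

definition thr :: "nat \<Rightarrow> ereal" where
  "thr i = ex_ante_price (law I i) (demand_load I x i)"

definition late_wt :: "nat \<Rightarrow> real" where
  "late_wt i = cond_mean (law I i) (thr i)"

text \<open>With the prices frozen at \<open>thr\<close>, the relaxed value of \<open>x\<close> is
  linear with these coefficients, the form in which the expected outcome of the simulation is
  computed.\<close>

definition edge_wt :: "nat \<times> nat \<Rightarrow> real" where
  "edge_wt e = (if fst e \<in> early I then cond_mean (law I (fst e)) (ereal (posted I (fst e)))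
     else late_wt (fst e)) + supply_wt I (snd e)"

lemma relaxed_value_eq_sum_edges:
  "relaxed_value I x = (\<Sum>j\<in>supplies I. \<Sum>i\<in>early I \<union> late I. x i j * edge_wt (i, j))"
proof -
  let ?w = "\<lambda>i. if i \<in> early I then cond_mean (law I i) (ereal (posted I i)) else late_wt i"
  have "edge_wt (i, j) = ?w i + supply_wt I j" for i j
    by (simp add: edge_wt_def cong: if_cong)
  then have "(\<Sum>j\<in>supplies I. \<Sum>i\<in>early I \<union> late I. x i j * edge_wt (i, j)) =
      (\<Sum>j\<in>supplies I. \<Sum>i\<in>early I \<union> late I. x i j * ?w i)
      + (\<Sum>j\<in>supplies I. \<Sum>i\<in>early I \<union> late I. x i j * supply_wt I j)"
    by (simp add: distrib_left sum.distrib)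
  also have "(\<Sum>j\<in>supplies I. \<Sum>i\<in>early I \<union> late I. x i j * ?w i)
      = (\<Sum>i\<in>early I \<union> late I. ?w i * demand_load I x i)"
    by (subst sum.swap) (simp add: demand_load_altdef sum_distrib_left sum_distrib_right mult.commute)
  also have "\<dots> = (\<Sum>i\<in>early I. ?w i * demand_load I x i) + (\<Sum>i\<in>late I. ?w i * demand_load I x i)"
    by (rule sum.union_disjoint) (use early_late_disjoint in auto)
  also have "(\<Sum>i\<in>late I. ?w i * demand_load I x i) = (\<Sum>i\<in>late I. late_wt i * demand_load I x i)"
    using early_late_disjoint by (intro sum.cong) auto
  also have "(\<Sum>j\<in>supplies I. \<Sum>i\<in>early I \<union> late I. x i j * supply_wt I j)
      = (\<Sum>j\<in>supplies I. supply_wt I j * supply_load I x j)"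
    by (simp add: supply_load_altdef sum_distrib_left mult.commute)
  finally show ?thesis
    by (simp add: relaxed_value_def late_wt_def thr_def)
qed

text \<open>The indicator of an accepting set is a product of one factor per late vertex, so
  independence applies. The last two claims explain why the second stage may optimize
  \<open>late_wt\<close> without seeing the values: given the accepting set, each accepting vertex
  is worth its conditional mean.\<close>

lemma integral_accepting:
  assumes "B \<subseteq> late I"
  shows "integrable (value_law I) (\<lambda>v. of_bool (accepting I thr v = B) :: real)"
    and "(LINT v|value_law I. of_bool (accepting I thr v = B)) = accept_prob (late I) B"
    and "i \<in> B \<Longrightarrow> integrable (value_law I) (\<lambda>v. v i * of_bool (accepting I thr v = B))"
    and "i \<in> B \<Longrightarrow> (LINT v|value_law I. v i * of_bool (accepting I thr v = B))
      = late_wt i * accept_prob (late I) B"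
proof -
  define g :: "nat \<Rightarrow> real \<Rightarrow> real" where "g = (\<lambda>k t. if k \<in> B then indicator {t. thr k \<le> ereal t} t
    else 1 - indicator {t. thr k \<le> ereal t} t)"
  define q where "q = (\<lambda>k. if k \<in> B then demand_load I x k else 1 - demand_load I x k)"
  have prod_g: "of_bool (accepting I thr v = B) = (\<Prod>k\<in>late I. g k (v k))" for v
  proof (cases "accepting I thr v = B")
    case True
    then have "g k (v k) = 1" if "k \<in> late I" for k
      using that by (auto simp: g_def accepting_def)
    with True show ?thesis by simp
  next
    case False
    then obtain k where k: "k \<in> late I" "k \<in> B \<longleftrightarrow> \<not> thr k \<le> ereal (v k)"
      using assms unfolding accepting_def by blast
    then have "g k (v k) = 0" by (auto simp: g_def)
    then have "(\<Prod>k\<in>late I. g k (v k)) = 0" using k by (intro prod_zero) auto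
    then show ?thesis using False by simp
  qed
  have late: "integrable (law I k) (g k)" "(LINT t|law I k. g k t) = q k"
     "integrable (law I k) (\<lambda>t. t * g k t)"
     "k \<in> B \<Longrightarrow> (LINT t|law I k. t * g k t) = late_wt k * q k" if k: "k \<in> late I" for k
  proof -
    interpret real_distribution "law I k" by (rule valid_market_late_law[OF valid k])
    have m: "measure (law I k) {t. thr k \<le> ereal t} = demand_load I x k"
      unfolding thr_def using valid_market_late_law[OF valid k] demand_load_nonneg demand_load_le_1 k
      by (intro measure_ex_ante_price) auto
    have [measurable]: "{t. thr k \<le> ereal t} \<in> sets borel" by measurable
    have ind: "integrable (law I k) (indicator {t. thr k \<le> ereal t} :: real \<Rightarrow> real)"
      by (intro integrable_real_indicator) (auto simp: emeasure_eq_measure)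
    then show "integrable (law I k) (g k)" by (cases "k \<in> B") (auto simp: g_def)
    show "(LINT t|law I k. g k t) = q k"
      using ind m prob_space by (auto simp: g_def q_def)
    have [measurable]: "g k \<in> borel_measurable borel" by (cases "k \<in> B") (simp_all add: g_def)
    show "integrable (law I k) (\<lambda>t. t * g k t)"
      by (rule Bochner_Integration.integrable_bound[OF valid_market_late_law(3)[OF valid k]])
         (auto simp: g_def split: split_indicator)
    show "(LINT t|law I k. t * g k t) = late_wt k * q k" if "k \<in> B"
      using that cond_mean_mult_measure[of "law I k" "thr k"] m finite_measure_axioms
      by (simp add: g_def q_def late_wt_def)
  qed
  have q: "accept_prob (late I) B = (\<Prod>k\<in>late I. q k)"
    by (simp add: accept_prob_def q_def)
  show "integrable (value_law I) (\<lambda>v. of_bool (accepting I thr v = B) :: real)"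
    unfolding prod_g by (rule integral_prod_value_law(1)[OF valid late(1)])
  show "(LINT v|value_law I. of_bool (accepting I thr v = B)) = accept_prob (late I) B"
    unfolding prod_g q using integral_prod_value_law(2)[OF valid late(1)] late(2) by simp
  assume i: "i \<in> B"
  \<comment> \<open>Multiplying the factor at \<open>i\<close> by its value keeps the integrand a
    product over the late vertices.\<close>
  define f where "f = (\<lambda>k t. (if k = i then t else 1) * g k t)"
  have prod_f: "v i * of_bool (accepting I thr v = B) = (\<Prod>k\<in>late I. f k (v k))" for v
  proof -
    have "(\<Prod>k\<in>late I. f k (v k)) = (\<Prod>k\<in>late I. if k = i then v k else 1) * (\<Prod>k\<in>late I. g k (v k))"
      by (simp add: f_def prod.distrib)
    then show ?thesis using i assms by (auto simp: prod_g prod.delta)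
  qed
  have f_int: "integrable (law I k) (f k)" if "k \<in> late I" for k
    using late[OF that] by (cases "k = i") (simp_all add: f_def)
  have f_val: "(LINT t|law I k. f k t) = (if k = i then late_wt i else 1) * q k" if "k \<in> late I" for k
    using late[OF that] i by (cases "k = i") (simp_all add: f_def)
  show "integrable (value_law I) (\<lambda>v. v i * of_bool (accepting I thr v = B))"
    unfolding prod_f by (rule integral_prod_value_law(1)[OF valid f_int])
  have "(LINT v|value_law I. v i * of_bool (accepting I thr v = B))
      = (\<Prod>k\<in>late I. (if k = i then late_wt i else 1) * q k)"
    unfolding prod_f by (subst integral_prod_value_law(2)[OF valid f_int]) (simp_all add: f_val)
  also have "\<dots> = late_wt i * (\<Prod>k\<in>late I. q k)"
    using i assms by (auto simp: prod.distrib prod.delta)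
  finally show "(LINT v|value_law I. v i * of_bool (accepting I thr v = B)) = late_wt i * accept_prob (late I) B"
    by (simp add: q)
qed

end

locale ex_ante_run = relaxed_solution +
  fixes ord :: "nat list" and sel :: "(nat \<times> nat) set \<Rightarrow> nat set \<Rightarrow> (nat \<times> nat) set"
  assumes distinct_ord: "distinct ord" and set_ord: "set ord = early I"
    and sel: "\<And>M B. B \<subseteq> late I \<Longrightarrow>
      max_weight_matching (stage2_edges I M B) late_wt (supply_wt I) (sel M B)"
begin

abbreviation first_stage :: "(nat \<times> nat) set pmf" where
  "first_stage \<equiv> simulate_discard I x ord (\<lambda>_. 0) {}"

text \<open>The potential that serves as \<open>V\<close> in the domination bound: what the
  simulation has collected, plus the best completion if \<open>B\<close> accepts. In that use
  \<open>M\<close> may contain late edges.\<close>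

definition total_wt :: "(nat \<times> nat) set \<Rightarrow> nat set \<Rightarrow> real" where
  "total_wt M B = (\<Sum>e\<in>M. edge_wt e) + match_weight late_wt (supply_wt I) (sel M B)"

lemma first_stageD:
  assumes "M \<in> set_pmf first_stage"
  shows "matching (stage1_edges I) M"
proof -
  have "matching (edges I) M" "fst ` M \<subseteq> early I"
    using set_simulate_discard[OF distinct_ord _ matching_empty _ assms] set_ord by auto
  then show ?thesis by (auto simp: matching_def stage1_edges_def)
qed

lemma sel_matching: "B \<subseteq> late I \<Longrightarrow> matching (stage2_edges I M B) (sel M B)"
  and sel_max: "B \<subseteq> late I \<Longrightarrow> matching (stage2_edges I M B) M' \<Longrightarrow>
    match_weight late_wt (supply_wt I) M' \<le> match_weight late_wt (supply_wt I) (sel M B)"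
  using sel by (auto simp: max_weight_matching_def)

lemma finite_matching: "matching (edges I) M \<Longrightarrow> finite M"
  by (auto simp: matching_def intro: finite_subset[OF _ finite_edges])

lemma half_relaxed_value_le:
  "relaxed_value I x / 2 \<le> measure_pmf.expectation first_stage
     (\<lambda>M. \<Sum>B\<in>Pow (late I). accept_prob (late I) B * total_wt M B)"
proof -
  obtain lo where lo: "distinct lo" "set lo = late I"
    using finite_distinct_list[OF finite_late] by blast
  let ?\<theta> = "\<lambda>j. \<Sum>i\<leftarrow>ord. x i j"
  have loads: "(\<Sum>i\<in>early I. x i j) + (\<Sum>i\<in>late I. x i j) \<le> 1" if "j \<in> supplies I" for j
    using supply_load_le_1[OF that] early_late_disjoint
    by (simp add: supply_load_altdef sum.union_disjoint)
  have late_le: "measure_pmf.expectation (simulate_discard I x lo ?\<theta> M) (\<lambda>N. \<Sum>e\<in>N. edge_wt e)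
      \<le> (\<Sum>B\<in>Pow (late I). accept_prob (late I) B * total_wt M B)" if "finite M" for M
    unfolding lo(2)[symmetric]
  proof (rule expectation_simulate_discard_le)
    show "(\<Sum>e\<in>M. edge_wt e) \<le> total_wt M {}" for M
      using sel_max[of "{}" M "{}"] by (simp add: total_wt_def match_weight_def)
    \<comment> \<open>The selection for \<open>B\<close> remains admissible when \<open>i\<close>
      accepts as well.\<close>
    show "total_wt M B \<le> total_wt M (insert i B)" if "i \<in> late I" "B \<subseteq> late I" for M B i
    proof -
      have "matching (stage2_edges I M (insert i B)) (sel M B)"
        using sel_matching[OF that(2)] by (rule matching_mono) (auto simp: stage2_edges_def)
      then show ?thesis using that by (simp add: total_wt_def sel_max)
    qed
    \<comment> \<open>Moving \<open>(i, j)\<close> from the collected edges into the second-stage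
      matching gives a competitor of equal total weight.\<close>
    show "total_wt (insert (i, j) M) B \<le> total_wt M (insert i B)"
      if *: "i \<in> late I - B" "B \<subseteq> late I" "(i, j) \<in> edges I" "j \<notin> snd ` M" "finite M" for M B i j
    proof -
      let ?N = "sel (insert (i, j) M) B"
      have N: "matching (stage2_edges I (insert (i, j) M) B) ?N" by (rule sel_matching) fact
      have out: "i \<notin> fst ` ?N" "j \<notin> snd ` ?N"
        using N * by (auto simp: matching_def stage2_edges_def)
      have "finite ?N"
        using N by (intro finite_matching matching_mono[OF N]) (auto simp: stage2_edges_def)
      have mN: "matching (stage2_edges I M (insert i B)) (insert (i, j) ?N)"
        using N out * by (auto simp: matching_def stage2_edges_def inj_on_insert)
      have "match_weight late_wt (supply_wt I) (insert (i, j) ?N)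
          = late_wt i + supply_wt I j + match_weight late_wt (supply_wt I) ?N"
        using out \<open>finite ?N\<close> by (simp add: match_weight_def)
      moreover have "edge_wt (i, j) = late_wt i + supply_wt I j"
        using * early_late_disjoint by (auto simp: edge_wt_def)
      moreover have "(i, j) \<notin> M" using * by force
      ultimately show ?thesis
        using sel_max[OF _ mN] * by (simp add: total_wt_def)
    qed
    show "?\<theta> j + (\<Sum>i\<in>set lo. x i j) \<le> 1" if "j \<in> supplies I" for j
      using loads[OF that] distinct_ord set_ord lo by (simp add: sum_list_distinct_conv_sum_set)
  qed (use lo that in auto)
  \<comment> \<open>The run starts with \<open>\<theta> = 0\<close>, so the common factor
    \<open>1 / (2 - \<theta> j)\<close> is 1/2 for every edge, early or late.\<close>
  have "(\<Sum>j\<in>supplies I. \<Sum>i\<in>early I \<union> late I. x i j * edge_wt (i, j) / 2)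
      = measure_pmf.expectation (simulate_discard I x (ord @ lo) (\<lambda>_. 0) {}) (\<lambda>N. \<Sum>e\<in>N. edge_wt e)"
    using loads distinct_ord set_ord lo early_late_disjoint
    by (subst expectation_simulate_discard) (auto simp: sum.union_disjoint)
  also have "\<dots> = (\<Sum>M\<in>set_pmf first_stage. pmf first_stage M *\<^sub>R
      measure_pmf.expectation (simulate_discard I x lo ?\<theta> M) (\<lambda>N. \<Sum>e\<in>N. edge_wt e))"
    unfolding simulate_discard_append add_0 using set_ord lo
    by (intro pmf_expectation_bind finite_set_simulate_discard) auto
  also have "\<dots> \<le> (\<Sum>M\<in>set_pmf first_stage. pmf first_stage M *\<^sub>R
      (\<Sum>B\<in>Pow (late I). accept_prob (late I) B * total_wt M B))"
  proof (intro sum_mono scaleR_left_mono late_le)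
    fix M assume "M \<in> set_pmf first_stage"
    then have "matching (edges I) M"
      by (intro matching_mono[OF first_stageD]) (auto simp: stage1_edges_def)
    then show "finite M" by (rule finite_matching)
  qed simp
  also have "\<dots> = measure_pmf.expectation first_stage
     (\<lambda>M. \<Sum>B\<in>Pow (late I). accept_prob (late I) B * total_wt M B)"
    using set_ord by (intro integral_measure_pmf[symmetric] finite_set_simulate_discard) auto
  finally show ?thesis
    by (simp add: relaxed_value_eq_sum_edges sum_divide_distrib)
qed

text \<open>The second stage depends on the values only through the accepting set. Splitting by this
  set makes the integrand a finite sum of products of a function of the seed and a function of the
  values, which are independent.\<close>

lemma efficiency_ex_ante_strategy:
  "efficiency I (ex_ante_strategy I x ord sel) = measure_pmf.expectation first_stage
     (\<lambda>M. \<Sum>B\<in>Pow (late I). accept_prob (late I) B * total_wt M B)"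
proof -
  let ?P = "value_law I" and ?S = "measure_pmf first_stage"
  let ?w = "\<lambda>i. cond_mean (law I i) (ereal (posted I i))"
  define \<phi> where "\<phi> = (\<lambda>B M. (\<Sum>i\<in>early I \<inter> fst ` M. ?w i)
    + (\<Sum>j\<in>supplies I \<inter> snd ` (M \<union> sel M B). supply_wt I j))"
  define \<psi> :: "nat set \<Rightarrow> nat \<Rightarrow> (nat \<times> nat) set \<Rightarrow> real"
    where "\<psi> = (\<lambda>B i M. indicator (fst ` sel M B) i)"
  define \<iota> :: "nat set \<Rightarrow> (nat \<Rightarrow> real) \<Rightarrow> real" where "\<iota> = (\<lambda>B v. of_bool (accepting I thr v = B))"
  have fin_set: "finite (set_pmf first_stage)" using set_ord by (intro finite_set_simulate_discard) auto
  have intS: "integrable ?S f" for f :: "(nat \<times> nat) set \<Rightarrow> real"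
    by (rule integrable_measure_pmf_finite) (rule fin_set)
  note prob = measure_pmf.prob_space_axioms prob_space_value_law[OF valid]
  have \<iota>_int: "integrable ?P (\<iota> B)" "(LINT v|?P. \<iota> B v) = accept_prob (late I) B"
    "i \<in> B \<Longrightarrow> integrable ?P (\<lambda>v. v i * \<iota> B v)"
    "i \<in> B \<Longrightarrow> (LINT v|?P. v i * \<iota> B v) = late_wt i * accept_prob (late I) B"
    if "B \<subseteq> late I" for B i
    unfolding \<iota>_def using integral_accepting[OF that] by auto
  have integrand: "(let M1 = M; A = accepting I thr v; M2 = sel M A in
        (\<Sum>i\<in>early I \<inter> fst ` M1. ?w i) + (\<Sum>i\<in>A \<inter> fst ` M2. v i) +
        (\<Sum>j\<in>supplies I \<inter> snd ` (M1 \<union> M2). supply_wt I j)) =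
      (\<Sum>B\<in>Pow (late I). \<phi> B M * \<iota> B v + (\<Sum>i\<in>B. \<psi> B i M * (v i * \<iota> B v)))" for M v
  proof -
    define A where "A = accepting I thr v"
    have A: "A \<in> Pow (late I)" by (auto simp: A_def accepting_def)
    then have "finite A" by (auto intro: finite_subset[OF _ finite_late])
    have "(\<Sum>B\<in>Pow (late I). \<phi> B M * \<iota> B v + (\<Sum>i\<in>B. \<psi> B i M * (v i * \<iota> B v))) =
        (\<Sum>B\<in>Pow (late I). if B = A then \<phi> A M + (\<Sum>i\<in>A. \<psi> A i M * v i) else 0)"
      by (rule sum.cong) (auto simp: \<iota>_def A_def)
    also have "\<dots> = \<phi> A M + (\<Sum>i\<in>A. \<psi> A i M * v i)"
      using A by (simp add: sum.delta)
    also have "(\<Sum>i\<in>A. \<psi> A i M * v i) = (\<Sum>i\<in>A \<inter> fst ` sel M A. v i)"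
      using \<open>finite A\<close> by (intro sum.mono_neutral_cong_right) (auto simp: \<psi>_def)
    finally show ?thesis by (simp add: \<phi>_def A_def Let_def)
  qed
  have "efficiency I (ex_ante_strategy I x ord sel) = (LINT (M, v)|(?S \<Otimes>\<^sub>M ?P).
      (\<Sum>B\<in>Pow (late I). \<phi> B M * \<iota> B v + (\<Sum>i\<in>B. \<psi> B i M * (v i * \<iota> B v))))"
    unfolding efficiency_def ex_ante_strategy_def strategy.simps thr_def[symmetric] integrand ..
  also have "\<dots> = (LINT z|(?S \<Otimes>\<^sub>M ?P). (\<Sum>B\<in>Pow (late I). (case z of (M, v) \<Rightarrow> \<phi> B M * \<iota> B v)
      + (\<Sum>i\<in>B. case z of (M, v) \<Rightarrow> \<psi> B i M * (v i * \<iota> B v))))"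
    by (simp add: case_prod_unfold)
  also have "\<dots> = (\<Sum>B\<in>Pow (late I). (LINT (M, v)|(?S \<Otimes>\<^sub>M ?P). \<phi> B M * \<iota> B v)
      + (\<Sum>i\<in>B. LINT (M, v)|(?S \<Otimes>\<^sub>M ?P). \<psi> B i M * (v i * \<iota> B v)))"
    using integral_pair_times(1)[OF prob intS \<iota>_int(1)] integral_pair_times(1)[OF prob intS \<iota>_int(3)]
    by (subst Bochner_Integration.integral_sum) (auto intro!: sum.cong)
  also have "\<dots> = (\<Sum>B\<in>Pow (late I). (LINT M|?S. \<phi> B M) * accept_prob (late I) B
      + (\<Sum>i\<in>B. (LINT M|?S. \<psi> B i M) * (late_wt i * accept_prob (late I) B)))"
    using integral_pair_times(2)[OF prob intS \<iota>_int(1)] integral_pair_times(2)[OF prob intS \<iota>_int(3)]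
    by (intro sum.cong arg_cong2[where f = "(+)"]) (auto simp: \<iota>_int)
  also have "\<dots> = (LINT M|?S. (\<Sum>B\<in>Pow (late I). accept_prob (late I) B *
      (\<phi> B M + (\<Sum>i\<in>B. \<psi> B i M * late_wt i))))"
    using intS by (simp add: algebra_simps sum_distrib_left sum_distrib_right)
  \<comment> \<open>The restriction to the support matters: \<open>M\<close> must be a first-stage
    matching for \<open>edge_wt\<close> to read off early weights and for the supply vertices of the
    two stages to be disjoint.\<close>
  also have "\<dots> = (LINT M|?S. (\<Sum>B\<in>Pow (late I). accept_prob (late I) B * total_wt M B))"
  proof (intro integral_cong_AE AE_pmfI sum.cong arg_cong2[where f = "(*)"] refl)
    fix M B assume M: "M \<in> set_pmf first_stage" and "B \<in> Pow (late I)"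
    then have B: "B \<subseteq> late I" "finite B" by (auto intro: finite_subset[OF _ finite_late])
    have M1: "matching (stage1_edges I) M" by (rule first_stageD) fact
    have M2: "matching (stage2_edges I M B) (sel M B)" by (rule sel_matching) fact
    have sub: "fst ` M \<subseteq> early I" "snd ` M \<subseteq> supplies I" "fst ` sel M B \<subseteq> B"
      "snd ` sel M B \<subseteq> supplies I"
      using M1 M2 edges_subset by (auto simp: matching_def stage1_edges_def stage2_edges_def)
    have "snd e \<notin> snd ` M" if "e \<in> sel M B" for e
      using M2 that by (force simp: matching_def stage2_edges_def)
    then have disj: "snd ` M \<inter> snd ` sel M B = {}" by force
    have fin: "finite (snd ` M)" "finite (snd ` sel M B)"
      using sub finite_subset[OF _ finite_supplies] by blast+
    have "(\<Sum>e\<in>M. edge_wt e) = (\<Sum>e\<in>M. ?w (fst e) + supply_wt I (snd e))"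
      using sub(1) by (intro sum.cong) (auto simp: edge_wt_def)
    also have "\<dots> = match_weight ?w (supply_wt I) M"
      by (rule match_weight_eq_sum_edges[OF M1, symmetric])
    finally have W: "(\<Sum>e\<in>M. edge_wt e) = (\<Sum>i\<in>fst ` M. ?w i) + (\<Sum>j\<in>snd ` M. supply_wt I j)"
      by (simp add: match_weight_def)
    have "(\<Sum>i\<in>B. \<psi> B i M * late_wt i) = (\<Sum>i\<in>fst ` sel M B. late_wt i)"
      using sub B by (intro sum.mono_neutral_cong_right) (auto simp: \<psi>_def)
    moreover have "(\<Sum>j\<in>supplies I \<inter> snd ` (M \<union> sel M B). supply_wt I j)
        = (\<Sum>j\<in>snd ` M. supply_wt I j) + (\<Sum>j\<in>snd ` sel M B. supply_wt I j)"
    proof -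
      have "supplies I \<inter> snd ` (M \<union> sel M B) = snd ` M \<union> snd ` sel M B" using sub by auto
      then show ?thesis using fin disj by (simp add: sum.union_disjoint)
    qed
    ultimately show "\<phi> B M + (\<Sum>i\<in>B. \<psi> B i M * late_wt i) = total_wt M B"
      using sub by (simp add: \<phi>_def W total_wt_def match_weight_def Int_absorb1)
  qed auto
  finally show ?thesis .
qed

lemma valid_ex_ante_strategy: "valid_strategy I (ex_ante_strategy I x ord sel)"
proof -
  have "AE M in measure_pmf first_stage. matching (stage1_edges I) M \<and>
      (\<forall>B\<subseteq>late I. matching (stage2_edges I M B) (sel M B))"
    using first_stageD sel_matching by (intro AE_pmfI) auto
  then show ?thesis
    unfolding valid_strategy_def ex_ante_strategy_def strategy.simps
    by (simp add: measure_pmf.prob_space_axioms)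
qed

lemma half_relaxed_value_le_efficiency:
  "relaxed_value I x / 2 \<le> efficiency I (ex_ante_strategy I x ord sel)"
  using half_relaxed_value_le by (simp add: efficiency_ex_ante_strategy)

end

subsection \<open>The hard market\<close>

definition ramp :: "real \<Rightarrow> real measure" where
  "ramp K = uniform_measure lborel {K - K\<^sup>2 / 2..K}"

text \<open>
  The interval has length \<open>K\<^sup>2 / 2\<close>, so that the positive part of a uniform value has mean 1,
  while its excess over 1 still has mean \<open>(1 - 1 / K)\<^sup>2\<close>.
\<close>

lemma ramp_eq_density:
  assumes "2 \<le> K"
  shows "ramp K = density lborel (\<lambda>t. ennreal (2 / K\<^sup>2 * indicator {K - K\<^sup>2 / 2..K} t))"
proof -
  have "emeasure lborel {K - K\<^sup>2 / 2..K} = ennreal (K\<^sup>2 / 2)"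
    using assms by simp
  moreover have "1 / ennreal (K\<^sup>2 / 2) = ennreal (2 / K\<^sup>2)"
    using divide_ennreal[of 1 "K\<^sup>2 / 2"] assms by simp
  ultimately show ?thesis
    unfolding ramp_def uniform_measure_def
    by (intro density_cong) (auto split: split_indicator)
qed

lemma integral_ramp:
  fixes f :: "real \<Rightarrow> real"
  assumes "2 \<le> K" "f \<in> borel_measurable borel"
  shows "integrable (ramp K) f \<longleftrightarrow> integrable lborel (\<lambda>t. f t * indicator {K - K\<^sup>2 / 2..K} t)"
    and "(LINT t|ramp K. f t) = 2 / K\<^sup>2 * (LINT t|lborel. f t * indicator {K - K\<^sup>2 / 2..K} t)"
proof -
  let ?I = "{K - K\<^sup>2 / 2..K}"
  have eq: "(\<lambda>t. (2 / K\<^sup>2 * indicator ?I t) *\<^sub>R f t) = (\<lambda>t. 2 / K\<^sup>2 * (f t * indicator ?I t))"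
    by (simp add: fun_eq_iff)
  have "integrable (ramp K) f \<longleftrightarrow> integrable lborel (\<lambda>t. (2 / K\<^sup>2 * indicator ?I t) *\<^sub>R f t)"
    unfolding ramp_eq_density[OF assms(1)] using assms(2) by (intro integrable_density) auto
  then show "integrable (ramp K) f \<longleftrightarrow> integrable lborel (\<lambda>t. f t * indicator ?I t)"
    unfolding eq using assms(1) by (simp only: integrable_mult_left_iff) auto
  have "(LINT t|ramp K. f t) = (LINT t|lborel. (2 / K\<^sup>2 * indicator ?I t) *\<^sub>R f t)"
    unfolding ramp_eq_density[OF assms(1)] using assms(2) by (intro integral_density) auto
  then show "(LINT t|ramp K. f t) = 2 / K\<^sup>2 * (LINT t|lborel. f t * indicator ?I t)"
    unfolding eq by (simp only: integral_mult_right_zero)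
qed

lemma prob_space_ramp: "2 \<le> K \<Longrightarrow> prob_space (ramp K)"
  unfolding ramp_def by (rule prob_space_uniform_measure) auto

lemma real_distribution_ramp:
  assumes "2 \<le> K"
  shows "real_distribution (ramp K)"
  using prob_space_ramp[OF assms]
  by (simp add: real_distribution_def real_distribution_axioms_def) (simp add: ramp_def)

text \<open>Used at two levels: \<open>s = 0\<close> bounds what a policy can get from the late
  vertex, and \<open>s = 1\<close> is what the benchmark gains over the early one.\<close>

lemma integral_excess_ramp:
  assumes K: "2 \<le> K" and s: "0 \<le> s" "s \<le> K"
  shows "integrable (ramp K) (\<lambda>t. max 0 (t - s))"
    and "(LINT t|ramp K. max 0 (t - s)) = ((K - s) / K)\<^sup>2"
proof -
  \<comment> \<open>The support starts at or below 0, hence cutting at \<open>s\<close> leaves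
    exactly the interval from \<open>s\<close> to \<open>K\<close>.\<close>
  have "K - K\<^sup>2 / 2 \<le> 0" using K mult_right_mono[of 2 K K] by (simp add: power2_eq_square)
  then have eq: "max 0 (t - s) * indicator {K - K\<^sup>2 / 2..K} t = (t - s) * indicator {s..K} t" for t
    using s by (auto split: split_indicator)
  have "has_bochner_integral lborel (\<lambda>t. (t - s) * indicator {s..K} t) ((K - s)\<^sup>2 / 2 - (s - s)\<^sup>2 / 2)"
    using s by (intro has_bochner_integral_FTC_Icc_real) (auto intro!: derivative_eq_intros)
  then have "integrable lborel (\<lambda>t. max 0 (t - s) * indicator {K - K\<^sup>2 / 2..K} t)"
    "(LINT t|lborel. max 0 (t - s) * indicator {K - K\<^sup>2 / 2..K} t) = (K - s)\<^sup>2 / 2"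
    unfolding eq by (auto simp: has_bochner_integral_iff)
  then show "integrable (ramp K) (\<lambda>t. max 0 (t - s))" "(LINT t|ramp K. max 0 (t - s)) = ((K - s) / K)\<^sup>2"
    using K by (auto simp: integral_ramp power_divide)
qed

definition hard_market :: "real \<Rightarrow> market" where
  "hard_market K = \<lparr>early = {0}, late = {1}, supplies = {0}, edges = {(0, 0), (1, 0)},
     supply_wt = (\<lambda>_. 0), law = (\<lambda>i. if i = 0 then return borel 1 else ramp K), posted = (\<lambda>_. 1)\<rparr>"

lemma hard_market_simps [simp]:
  "early (hard_market K) = {0}" "late (hard_market K) = {1}" "supplies (hard_market K) = {0}"
  "edges (hard_market K) = {(0, 0), (1, 0)}" "supply_wt (hard_market K) j = 0"
  "law (hard_market K) 0 = return borel 1" "law (hard_market K) (Suc 0) = ramp K"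
  "posted (hard_market K) i = 1"
  by (simp_all add: hard_market_def)

lemma cond_mean_return: "cond_mean (return borel 1) 1 = 1"
proof -
  have [measurable]: "{v. 1 \<le> ereal v} \<in> sets borel" by measurable
  have "(LINT v|return borel 1. v * indicator {v. 1 \<le> ereal v} v) = (1::real)"
    by (subst integral_return) (auto simp: one_ereal_def)
  moreover have "measure (return borel 1) {v. 1 \<le> ereal v} = 1"
    by (subst measure_return) (auto simp: one_ereal_def)
  ultimately show ?thesis by (simp add: cond_mean_def)
qed

lemma valid_hard_market:
  assumes K: "2 \<le> K"
  shows "valid_market (hard_market K)"
proof -
  interpret real_distribution "ramp K" by (rule real_distribution_ramp) fact
  have "continuous_on UNIV (cdf (ramp K))"
  proof (intro continuous_at_imp_continuous_on ballI)
    fix t :: real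
    have "emeasure lborel ({K - K\<^sup>2 / 2..K} \<inter> {t}) = 0"
      by (rule emeasure_lborel_countable) auto
    then have "emeasure (ramp K) {t} = 0"
      by (simp add: ramp_def)
    then show "isCont (cdf (ramp K)) t" by (simp add: isCont_cdf measure_def)
  qed
  moreover have "integrable (ramp K) (\<lambda>v. v)"
  proof -
    have "integrable lborel (\<lambda>t. t * indicator {K - K\<^sup>2 / 2..K} t :: real)"
      using borel_integrable_atLeastAtMost'[of "K - K\<^sup>2 / 2" K "\<lambda>t. t"]
      by (simp add: set_integrable_def mult.commute)
    then show ?thesis using K by (simp add: integral_ramp)
  qed
  moreover have "integrable (return borel 1) (\<lambda>v::real. v)"
    by (rule integrableI_bounded) (auto simp: nn_integral_return)
  ultimately show ?thesis
    using prob_space_axioms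
    by (auto simp: valid_market_def prob_space_return measure_return)
qed

lemma integral_hard_value_law:
  fixes f :: "real \<Rightarrow> real"
  assumes "2 \<le> K" "f \<in> borel_measurable borel"
  shows "(LINT v|value_law (hard_market K). f (v (Suc 0))) = (LINT t|ramp K. f t)"
    and "integrable (ramp K) f \<Longrightarrow> integrable (value_law (hard_market K)) (\<lambda>v. f (v (Suc 0)))"
proof -
  note valid = valid_hard_market[OF assms(1)]
  have d: "distr (value_law (hard_market K)) borel (\<lambda>v. v (Suc 0)) = ramp K"
    and [measurable]: "(\<lambda>v. v (Suc 0)) \<in> borel_measurable (value_law (hard_market K))"
    using distr_value_law_component[OF valid, of "Suc 0"] measurable_value_law_component[OF valid, of "Suc 0"]
    by auto
  note [measurable] = assms(2)
  show "(LINT v|value_law (hard_market K). f (v (Suc 0))) = (LINT t|ramp K. f t)"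
    by (subst d[symmetric]) (simp add: integral_distr)
  show "integrable (ramp K) f \<Longrightarrow> integrable (value_law (hard_market K)) (\<lambda>v. f (v (Suc 0)))"
    by (subst (asm) d[symmetric]) (simp add: integrable_distr_eq)
qed

lemma hard_market_matchings:
  "{M. matching (edges (hard_market K)) M} = {{}, {(0, 0)}, {(1, 0)}}"
proof (intro set_eqI iffI)
  fix M assume M: "M \<in> {M. matching (edges (hard_market K)) M}"
  then have "M \<in> Pow {(0, 0), (1, 0)}" by (simp add: matching_def)
  then show "M \<in> {{}, {(0, 0)}, {(1, 0)}}"
    using M by (auto simp: Pow_insert matching_def)
qed (auto simp: matching_def)

lemma stage1_edges_hard_market: "stage1_edges (hard_market K) \<subseteq> {(0, 0)}"
  by (auto simp: stage1_edges_def)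

lemma stage2_edges_hard_market: "stage2_edges (hard_market K) {(0, 0)} A = {}"
  by (auto simp: stage2_edges_def)

lemma offline_opt_hard_market:
  assumes K: "2 \<le> K"
  shows "offline_opt (hard_market K) = 1 + ((K - 1) / K)\<^sup>2"
proof -
  interpret prob_space "ramp K" by (rule prob_space_ramp) fact
  \<comment> \<open>The maximum of 0, 1 and the late value, written so that the excess over 1
    appears.\<close>
  have "offline_opt (hard_market K) = (LINT v|value_law (hard_market K). 1 + max 0 (v (Suc 0) - 1))"
    unfolding offline_opt_def hard_market_matchings
  proof (rule Bochner_Integration.integral_cong[OF refl])
    fix v :: "nat \<Rightarrow> real"
    let ?mw = "match_weight (\<lambda>i. if i \<in> early (hard_market K)
      then cond_mean (law (hard_market K) i) (ereal (posted (hard_market K) i)) else v i)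
      (supply_wt (hard_market K))"
    have "?mw {} = 0" "?mw {(0, 0)} = 1" "?mw {(1, 0)} = v (Suc 0)"
      by (simp_all add: match_weight_def cond_mean_return one_ereal_def[symmetric])
    then have "?mw ` {{}, {(0, 0)}, {(1, 0)}} = {0, 1, v (Suc 0)}" by simp
    then show "Max (?mw ` {{}, {(0, 0)}, {(1, 0)}}) = 1 + max 0 (v (Suc 0) - 1)"
      by (simp only:) (simp add: max_def)
  qed
  also have "\<dots> = (LINT t|ramp K. 1 + max 0 (t - 1))"
    by (rule integral_hard_value_law(1)[OF K, of "\<lambda>t. 1 + max 0 (t - 1)"]) simp
  also have "\<dots> = 1 + ((K - 1) / K)\<^sup>2"
    using integral_excess_ramp[OF K, of 1] K prob_space
    by (subst Bochner_Integration.integral_add) auto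
  finally show ?thesis .
qed

text \<open>Giving the supply vertex to the early vertex earns 1; keeping it earns at most the
  positive part of the late value, of mean 1. The decision depends only on the seed, hence is
  independent of that value, and every mixture of the two earns at most 1.\<close>

lemma efficiency_hard_market_le_1:
  assumes K: "2 \<le> K" and R: "valid_strategy (hard_market K) R"
  shows "efficiency (hard_market K) R \<le> 1"
proof -
  let ?H = "hard_market K"
  let ?P = "value_law ?H"
  interpret S: prob_space "seed R" using R by (simp add: valid_strategy_def)
  interpret P: prob_space ?P by (rule prob_space_value_law[OF valid_hard_market[OF K]])
  define g :: "'a \<Rightarrow> real" where "g = (\<lambda>r. of_bool (match1 R r \<noteq> {}))"
  have match1_meas: "match1 R \<in> measurable (seed R) (count_space UNIV)"
    using R by (simp add: valid_strategy_def)
  have g_int: "integrable (seed R) g" "integrable (seed R) (\<lambda>r. 1 - g r)"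
  proof -
    have g_meas: "g \<in> borel_measurable (seed R)"
      unfolding g_def by (rule measurable_compose[OF match1_meas]) simp
    show g: "integrable (seed R) g"
      by (rule S.integrable_const_bound[OF _ g_meas, of 1]) (simp add: g_def)
    show "integrable (seed R) (\<lambda>r. 1 - g r)"
      using g by (intro Bochner_Integration.integrable_diff) simp_all
  qed
  have h: "integrable ?P (\<lambda>v. max 0 (v (Suc 0)))" "(LINT v|?P. max 0 (v (Suc 0))) = 1"
  proof -
    have m: "(\<lambda>t::real. max 0 (t - 0)) \<in> borel_measurable borel" by measurable
    have "0 \<le> K" and unit: "((K - 0) / K)\<^sup>2 = 1" using K by auto
    note e = integral_excess_ramp[OF K order_refl \<open>0 \<le> K\<close>]
    show "integrable ?P (\<lambda>v. max 0 (v (Suc 0)))"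
      using integral_hard_value_law(2)[OF K m e(1)] by (simp only: diff_zero)
    show "(LINT v|?P. max 0 (v (Suc 0))) = 1"
      using integral_hard_value_law(1)[OF K m] unfolding e(2) unit by (simp only: diff_zero)
  qed
  have one: "integrable ?P (\<lambda>_. 1 :: real)" by simp
  define F where "F = (\<lambda>z. (case z of (r, v) \<Rightarrow> g r * 1) + (case z of (r, v) \<Rightarrow> (1 - g r) * max 0 (v (Suc 0))))"
  note prob = S.prob_space_axioms P.prob_space_axioms
  note F1 = integral_pair_times[OF prob g_int(1) one]
  note F2 = integral_pair_times[OF prob g_int(2) h(1)]
  have F_int: "integrable (seed R \<Otimes>\<^sub>M ?P) F"
    unfolding F_def by (rule Bochner_Integration.integrable_add[OF F1(1) F2(1)])
  have ae: "AE r in seed R. matching (stage1_edges ?H) (match1 R r) \<and>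
      (\<forall>A\<subseteq>{Suc 0}. matching (stage2_edges ?H (match1 R r) A) (match2 R r A))"
    using R by (simp add: valid_strategy_def)
  have ae': "AE z in seed R \<Otimes>\<^sub>M ?P. matching (stage1_edges ?H) (match1 R (fst z)) \<and>
      (\<forall>A\<subseteq>{Suc 0}. matching (stage2_edges ?H (match1 R (fst z)) A) (match2 R (fst z) A))"
    using ae by (intro AE_distrD[OF measurable_fst]) (simp only: P.distr_pair_fst)
  have "efficiency ?H R \<le> (LINT z|(seed R \<Otimes>\<^sub>M ?P). F z)"
    unfolding efficiency_def
  \<comment> \<open>Nonnegativity of \<open>F\<close> also covers an integrand that is not
    integrable, whose integral is 0 by default.\<close>
  proof (rule integral_mono_AE'[OF F_int])
    show "AE z in seed R \<Otimes>\<^sub>M ?P. 0 \<le> F z"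
    proof (rule AE_I2)
      fix z :: "'a \<times> (nat \<Rightarrow> real)"
      have "0 \<le> g (fst z)" "0 \<le> 1 - g (fst z)" by (simp_all add: g_def)
      then show "0 \<le> F z" by (cases z) (simp add: F_def)
    qed
    show "AE z in seed R \<Otimes>\<^sub>M ?P. (case z of (r, v) \<Rightarrow>
       let M1 = match1 R r; A = accepting ?H (price R r) v; M2 = match2 R r A in
        (\<Sum>i\<in>early ?H \<inter> fst ` M1. cond_mean (law ?H i) (ereal (posted ?H i))) +
        (\<Sum>i\<in>A \<inter> fst ` M2. v i) +
        (\<Sum>j\<in>supplies ?H \<inter> snd ` (M1 \<union> M2). supply_wt ?H j)) \<le> F z"
      using ae'
    proof eventually_elim
      case (elim z)
      obtain r v where z: "z = (r, v)" by (cases z)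
      define A where "A = accepting ?H (price R r) v"
      have A: "A \<subseteq> {Suc 0}" by (auto simp: A_def accepting_def)
      have "match1 R r \<subseteq> stage1_edges ?H" and M2: "match2 R r A \<subseteq> stage2_edges ?H (match1 R r) A"
        using elim A unfolding z fst_conv matching_def by blast+
      with stage1_edges_hard_market have M1: "match1 R r \<subseteq> {(0, 0)}" by blast
      \<comment> \<open>This bound holds for every price and every acceptance decision.\<close>
      have late_le: "(\<Sum>i\<in>A \<inter> fst ` match2 R r A. v i) \<le> max 0 (v (Suc 0))"
      proof -
        have "A \<inter> fst ` match2 R r A = {} \<or> A \<inter> fst ` match2 R r A = {Suc 0}"
          using A by (intro subset_singletonD le_infI1)
        then show ?thesis
        proof
          assume e: "A \<inter> fst ` match2 R r A = {}"
          show ?thesis unfolding e by simp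
        next
          assume e: "A \<inter> fst ` match2 R r A = {Suc 0}"
          show ?thesis unfolding e by simp
        qed
      qed
      have "match1 R r = {} \<or> match1 R r = {(0, 0)}" using M1 by (rule subset_singletonD)
      then show ?case
      proof
        assume "match1 R r = {}"
        then have "g r = 0" by (simp add: g_def)
        then have "F z = max 0 (v (Suc 0))" by (simp add: z F_def)
        with late_le \<open>match1 R r = {}\<close> show ?case
          unfolding z prod.case Let_def A_def[symmetric] by simp
      next
        assume M1: "match1 R r = {(0, 0)}"
        with M2 stage2_edges_hard_market have "match2 R r A = {}" by simp
        moreover have "F z = 1" using M1 by (simp add: z F_def g_def)
        ultimately show ?case
          using M1 unfolding z prod.case Let_def A_def[symmetric]
          by (simp add: cond_mean_return one_ereal_def[symmetric])
      qed
    qed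
  qed
  also have "\<dots> = (LINT r|seed R. g r) * 1 + (LINT r|seed R. 1 - g r) * 1"
    unfolding F_def Bochner_Integration.integral_add[OF F1(1) F2(1)] F1(2) F2(2) h(2)
    by (simp add: P.prob_space)
  also have "\<dots> = 1"
    using g_int S.prob_space by simp
  finally show ?thesis .
qed

lemma competitive_ratio_le_half:
  assumes P: "valid_policy P"
  shows "\<not> competitive_ratio P > 1 / 2"
proof
  assume "competitive_ratio P > 1 / 2"
  then obtain c where c: "1 / 2 < ereal c" "ereal c < competitive_ratio P"
    using ereal_dense2 by blast
  then have "1 / 2 < c" by (simp add: one_ereal_def numeral_eq_ereal)
  \<comment> \<open>Chosen to make \<open>2 / K \<le> 2 - 1 / c\<close>, so that the benchmark is at
    least \<open>2 - 2 / K \<ge> 1 / c\<close>, while a ratio above \<open>c\<close> would keep it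
    below \<open>1 / c\<close>. The maximum with 2 is the range of the hard market.\<close>
  define K where "K = max 2 (2 / (2 - 1 / c))"
  have "0 < 2 - 1 / c" using \<open>1 / 2 < c\<close> by (simp add: field_simps)
  have K: "2 \<le> K" by (simp add: K_def)
  let ?o = "offline_opt (hard_market K)"
  have o: "?o = 1 + ((K - 1) / K)\<^sup>2" by (rule offline_opt_hard_market[OF K])
  then have pos: "0 < ?o" by (simp add: add_pos_nonneg)
  have "competitive_ratio P \<le> ereal (efficiency (hard_market K) (P (hard_market K)) / ?o)"
    unfolding competitive_ratio_def using pos valid_hard_market[OF K] by (intro INF_lower) auto
  with c(2) have "ereal c < ereal (efficiency (hard_market K) (P (hard_market K)) / ?o)"
    by (rule less_le_trans)
  then have "c < efficiency (hard_market K) (P (hard_market K)) / ?o" by simp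
  also have "\<dots> \<le> 1 / ?o"
    using P valid_hard_market[OF K] pos
    by (intro divide_right_mono efficiency_hard_market_le_1[OF K]) (auto simp: valid_policy_def)
  finally have "c * ?o < 1" using pos by (simp add: field_simps)
  then have "?o < 1 / c" using \<open>1 / 2 < c\<close> by (simp add: field_simps)
  moreover have "2 - 2 / K \<le> ?o"
  proof -
    have "(K - 1) / K = 1 - 1 / K" using K by (simp add: diff_divide_distrib)
    then have "?o = 2 - 2 / K + (1 / K)\<^sup>2" by (simp add: o power2_diff)
    then show ?thesis by simp
  qed
  moreover have "2 / K \<le> 2 - 1 / c"
  proof -
    have "2 / (2 - 1 / c) \<le> K" by (simp add: K_def)
    then show ?thesis using K \<open>0 < 2 - 1 / c\<close> by (simp add: field_simps)
  qed
  ultimately show False by linarith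
qed

section \<open>Existence of the algorithm and its guarantee\<close>

lemma max_weight_matching_exists:
  assumes "finite E"
  shows "\<exists>M. max_weight_matching E a b M"
proof -
  let ?W = "match_weight a b ` {M. matching E M}"
  have "finite ?W" "?W \<noteq> {}" using finite_matchings[OF assms] matching_empty by blast+
  then have "Max ?W \<in> ?W" "\<forall>w\<in>?W. w \<le> Max ?W" by auto
  then show ?thesis unfolding max_weight_matching_def by fastforce
qed

text \<open>Keeps the guarantee from being vacuous. An instance picks a solution, an order and a
  selection for each valid market; the delicate point is that the relaxation attains its
  maximum.\<close>

lemma ex_ante_pricing_alg_exists: "\<exists>ALG. ex_ante_pricing_alg ALG"
proof -
  have "\<exists>S. valid_market I \<longrightarrow> (\<exists>x ord sel. relaxed_optimal I x \<and> distinct ord \<and> set ord = early I \<and>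
      (\<forall>M1. \<forall>A\<subseteq>late I. max_weight_matching (stage2_edges I M1 A)
        (\<lambda>i. cond_mean (law I i) (ex_ante_price (law I i) (demand_load I x i))) (supply_wt I) (sel M1 A)) \<and>
      S = ex_ante_strategy I x ord sel)" for I
  proof (cases "valid_market I")
    case True
    obtain x where x: "relaxed_optimal I x" using relaxed_optimal_exists[OF True] by blast
    obtain ord where ord: "distinct ord" "set ord = early I"
      using True finite_distinct_list[of "early I"] by (auto simp: valid_market_def)
    have "finite (stage2_edges I M1 A)" for M1 A
      by (rule finite_subset[OF _ valid_market_finite_edges[OF True]]) (auto simp: stage2_edges_def)
    then have "\<forall>M1 A. \<exists>M. max_weight_matching (stage2_edges I M1 A)
        (\<lambda>i. cond_mean (law I i) (ex_ante_price (law I i) (demand_load I x i))) (supply_wt I) M"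
      by (intro allI max_weight_matching_exists)
    then obtain sel where "\<forall>M1 A. max_weight_matching (stage2_edges I M1 A)
        (\<lambda>i. cond_mean (law I i) (ex_ante_price (law I i) (demand_load I x i))) (supply_wt I) (sel M1 A)"
      by metis
    with x ord show ?thesis by blast
  qed simp
  then show ?thesis unfolding ex_ante_pricing_alg_def by metis
qed

text \<open>The benchmark is at most the relaxed value of some feasible point, hence at most the
  relaxed optimum, of which the run earns at least half.\<close>

lemma ex_ante_pricing_alg_guarantee:
  assumes "ex_ante_pricing_alg ALG" "valid_market I"
  shows "valid_strategy I (ALG I)" "offline_opt I / 2 \<le> efficiency I (ALG I)"
proof -
  obtain x ord sel where opt: "relaxed_optimal I x" and ord: "distinct ord" "set ord = early I"
    and sel: "\<And>M1 A. A \<subseteq> late I \<Longrightarrow> max_weight_matching (stage2_edges I M1 A)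
        (\<lambda>i. cond_mean (law I i) (ex_ante_price (law I i) (demand_load I x i))) (supply_wt I) (sel M1 A)"
    and ALG: "ALG I = ex_ante_strategy I x ord sel"
    using assms unfolding ex_ante_pricing_alg_def by blast
  interpret relaxed_solution I x
    using assms opt by unfold_locales (auto simp: relaxed_optimal_def)
  interpret ex_ante_run I x ord sel
    using ord sel by unfold_locales (auto simp: late_wt_def[abs_def] thr_def)
  show "valid_strategy I (ALG I)"
    unfolding ALG by (rule valid_ex_ante_strategy)
  obtain x' where "feasible I x'" "offline_opt I \<le> relaxed_value I x'"
    using offline_opt_le_relaxed_value[OF assms(2)] by blast
  with opt have "offline_opt I \<le> relaxed_value I x"
    by (auto simp: relaxed_optimal_def intro: order_trans)
  then show "offline_opt I / 2 \<le> efficiency I (ALG I)"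
    unfolding ALG using half_relaxed_value_le_efficiency by linarith
qed

lemma ex_ante_pricing_alg_competitive_ratio:
  assumes "ex_ante_pricing_alg ALG"
  shows "competitive_ratio ALG \<ge> 1 / 2"
  unfolding competitive_ratio_def
proof (rule INF_greatest)
  fix I assume I: "I \<in> {I. valid_market I \<and> 0 < offline_opt I}"
  then have "1 / 2 \<le> efficiency I (ALG I) / offline_opt I"
    using ex_ante_pricing_alg_guarantee(2)[OF assms, of I] by (simp add: field_simps)
  then show "1 / 2 \<le> ereal (efficiency I (ALG I) / offline_opt I)"
    by (simp add: one_ereal_def numeral_eq_ereal)
qed

theorem theorem4:
  shows "(\<exists>ALG. ex_ante_pricing_alg ALG) \<and>
         (\<forall>ALG. ex_ante_pricing_alg ALG \<longrightarrow> valid_policy ALG \<and> competitive_ratio ALG \<ge> 1 / 2) \<and>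
         (\<forall>P :: 'r policy. valid_policy P \<longrightarrow> \<not> competitive_ratio P > 1 / 2)"
  using ex_ante_pricing_alg_exists ex_ante_pricing_alg_guarantee(1)
    ex_ante_pricing_alg_competitive_ratio competitive_ratio_le_half
  unfolding valid_policy_def by blast

end
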